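(* Let $B$ be a real uniformly convex Banach space having a weakly sequentially continuous duality mapping $J_\phi$, and let $C$ be a nonempty closed convex subset of $B$. Let $\{A_i\}_{i\ge0}$ be an infinite family of accretive operators $A_i:B\to2^B$ satisfying the range condition, with $$\overline{D(A_i)}\subset C\subset\bigcap_{r>0}R(I+rA_i)\quad\text{for each } i\ge0.$$ Let $r_n>0$ $(n\ge1)$ and $r>0$ be such that $\lim_{n\to\infty}r_n=r$, and let $J_{r_n}^{A_i}=(I+r_nA_i)^{-1}$ be the resolvent of $A_i$. Let $u,v_1\in C$ be arbitrary and let $\{v_n\}_{n\ge1}$ be a sequence generated by $$v_{n+1}=\xi_n u+(1-\zeta_n)J_{r_n}^{A_0}v_n+(\zeta_n-\xi_n)J_{r_n}^{A_0}w_n,\qquad w_n=\varphi_{n,0}v_n+\sum_{i=1}^{\infty}\varphi_{n,i}J_{r_n}^{A_i}v_n,\qquad n\ge1,$$ where $\{\zeta_n\}_{n\ge1}$, $\{\xi_n\}_{n\ge1}$ and $\{\varphi_{n,i}\}_{n\ge1,\,i\ge0}$ are sequences in $[0,1]$ satisfying: (1) $\lim_{n\to\infty}\xi_n=0$; (2) $\sum_{n=1}^{\infty}\xi_n=\infty$; (3) $\varphi_{n,0}+\sum_{i=1}^{\infty}\varphi_{n,i}=1$ for all $n\ge1$; (4) $\liminf_{n\to\infty}\zeta_n\varphi_{n,0}\varphi_{n,i}>0$ for all $i\ge1$. If $Z=\bigcap_{i=0}^{\infty}A_i^{-1}(0)\neq\varnothing$ and $Q_Z:B\to Z$ is the sunny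 nonexpansive retraction, then $\{v_n\}$ converges strongly, as $n\to\infty$, to $Q_Zu$.
   Context: A gauge function is a continuous strictly increasing map $\phi:[0,\infty)\to[0,\infty)$ with $\phi(0)=0$. The duality mapping with gauge $\phi$ is $J_\phi:B\to2^{B^*}$, $J_\phi a=\{f\in B^*:\langle a,f\rangle=\|a\|\|f\|,\ \|f\|=\phi(\|a\|)\}$; for $\phi(t)=t$ it is the normalized duality mapping $J$. $B$ has a weakly sequentially continuous duality mapping $J_\phi$ if, for some gauge $\phi$, $J_\phi$ is single-valued and sequentially continuous from the weak topology of $B$ to the weak$^*$ topology of $B^*$. For $A:B\to2^B$, $D(A)=\{a\in B:Aa\ne\varnothing\}$ is the domain, $R(A)$ is the range, and $A^{-1}(0)=\{a\in B:0\in Aa\}$. $A$ is accretive if for all $a,b\in D(A)$ and all $a'\in Aa$, $b'\in Ab$ there exists $j\in J(a-b)$ with $\langle a'-b',j\rangle\ge0$. $A$ satisfies the range condition if $\overline{D(A)}\subset R(I+rA)$ for all $r>0$. For accretive $A$ and $r>0$ the resolvent $J_r^A=(I+rA)^{-1}$ is a single-valued map from $R(I+rA)$ to $D(A)$. A map $Q:B\to Z$ is sunny if $Q(\delta x+(1-\delta)Qx)=Qx$ for all $x\in B$ and $\delta\in[0,1)$; it is a retraction onto $Z$ if $Q^2=Q$ and its range is $Z$; it is nonexpansive if $\|Qx-Qy\|\le\|x-y\|$ for all $x,y$. The iteration applies the resolvents to points of $C$, so the generated points $v_n,w_n$ are understood to lie in $C$. *)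

theory Defs
  imports "HOL-Analysis.Analysis"
begin

definition uniformly_convex :: "'a::real_normed_vector itself \<Rightarrow> bool" where
  "uniformly_convex _ \<longleftrightarrow>
     (\<forall>\<epsilon>>0. \<exists>\<delta>>0. \<forall>x y :: 'a.
        norm x \<le> 1 \<longrightarrow> norm y \<le> 1 \<longrightarrow> norm (x - y) \<ge> \<epsilon> \<longrightarrow>
        norm ((1 / 2) *\<^sub>R (x + y)) \<le> 1 - \<delta>)"

text \<open>The dual space of \<open>'a\<close> is \<open>'a \<Rightarrow>\<^sub>L real\<close> with the operator norm. Gauges are total
  functions on the reals; only their values on the half-line \<open>{0..}\<close> are ever used.\<close>

definition gauge_function :: "(real \<Rightarrow> real) \<Rightarrow> bool" where
  "gauge_function \<psi> \<longleftrightarrow>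
     \<psi> ` {0..} \<subseteq> {0..} \<and> continuous_on {0..} \<psi> \<and> strict_mono_on {0..} \<psi> \<and> \<psi> 0 = 0"

definition duality_map :: "(real \<Rightarrow> real) \<Rightarrow> 'a::real_normed_vector \<Rightarrow> ('a \<Rightarrow>\<^sub>L real) set" where
  "duality_map \<psi> a = {f. blinfun_apply f a = norm a * norm f \<and> norm f = \<psi> (norm a)}"

abbreviation normalized_duality_map :: "'a::real_normed_vector \<Rightarrow> ('a \<Rightarrow>\<^sub>L real) set" where
  "normalized_duality_map \<equiv> duality_map (\<lambda>t. t)"

definition weakly_converges :: "(nat \<Rightarrow> 'a::real_normed_vector) \<Rightarrow> 'a \<Rightarrow> bool" where
  "weakly_converges x l \<longleftrightarrow>
     (\<forall>f :: 'a \<Rightarrow>\<^sub>L real. (\<lambda>n. blinfun_apply f (x n)) \<longlonglongrightarrow> blinfun_apply f l)"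

definition weak_star_converges ::
    "(nat \<Rightarrow> ('a::real_normed_vector \<Rightarrow>\<^sub>L real)) \<Rightarrow> ('a \<Rightarrow>\<^sub>L real) \<Rightarrow> bool" where
  "weak_star_converges f g \<longleftrightarrow>
     (\<forall>x. (\<lambda>n. blinfun_apply (f n) x) \<longlonglongrightarrow> blinfun_apply g x)"

definition has_weakly_seq_continuous_duality_map :: "'a::real_normed_vector itself \<Rightarrow> bool" where
  "has_weakly_seq_continuous_duality_map _ \<longleftrightarrow>
     (\<exists>\<psi>. gauge_function \<psi> \<and>
       (\<exists>j :: 'a \<Rightarrow> ('a \<Rightarrow>\<^sub>L real).
          (\<forall>a. duality_map \<psi> a = {j a}) \<and>
          (\<forall>x l. weakly_converges x l \<longrightarrow> weak_star_converges (\<lambda>n. j (x n)) (j l))))"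

definition op_domain :: "('a \<Rightarrow> 'b set) \<Rightarrow> 'a set" where
  "op_domain T = {a. T a \<noteq> {}}"

definition op_range :: "('a \<Rightarrow> 'b set) \<Rightarrow> 'b set" where
  "op_range T = (\<Union>a. T a)"

definition op_inverse :: "('a \<Rightarrow> 'b set) \<Rightarrow> 'b \<Rightarrow> 'a set" where
  "op_inverse T b = {a. b \<in> T a}"

definition id_plus :: "real \<Rightarrow> ('a::real_vector \<Rightarrow> 'a set) \<Rightarrow> 'a \<Rightarrow> 'a set" where
  "id_plus r A x = (\<lambda>a. x + r *\<^sub>R a) ` A x"

definition accretive :: "('a::real_normed_vector \<Rightarrow> 'a set) \<Rightarrow> bool" where
  "accretive A \<longleftrightarrow>
     (\<forall>a \<in> op_domain A. \<forall>b \<in> op_domain A. \<forall>a' \<in> A a. \<forall>b' \<in> A b.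
        \<exists>j \<in> normalized_duality_map (a - b). blinfun_apply j (a' - b') \<ge> 0)"

definition range_condition :: "('a::real_normed_vector \<Rightarrow> 'a set) \<Rightarrow> bool" where
  "range_condition A \<longleftrightarrow> (\<forall>r>0. closure (op_domain A) \<subseteq> op_range (id_plus r A))"

text \<open>For accretive \<open>A\<close> and \<open>r > 0\<close> the set \<open>op_inverse (id_plus r A) y\<close> is a singleton when
  \<open>y\<close> lies in \<open>op_range (id_plus r A)\<close>; the value of \<open>resolvent r A y\<close> is unspecified for
  other \<open>y\<close>.\<close>

definition resolvent :: "real \<Rightarrow> ('a::real_vector \<Rightarrow> 'a set) \<Rightarrow> 'a \<Rightarrow> 'a" where
  "resolvent r A y = (THE x. x \<in> op_inverse (id_plus r A) y)"

definition sunny :: "('a::real_vector \<Rightarrow> 'a) \<Rightarrow> bool" where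
  "sunny Q \<longleftrightarrow> (\<forall>x. \<forall>\<delta>\<in>{0..<1}. Q (\<delta> *\<^sub>R x + (1 - \<delta>) *\<^sub>R Q x) = Q x)"

definition nonexpansive :: "('a::real_normed_vector \<Rightarrow> 'a) \<Rightarrow> bool" where
  "nonexpansive Q \<longleftrightarrow> (\<forall>x y. norm (Q x - Q y) \<le> norm (x - y))"

definition retraction_onto :: "('a \<Rightarrow> 'a) \<Rightarrow> 'a set \<Rightarrow> bool" where
  "retraction_onto Q Z \<longleftrightarrow> Q \<circ> Q = Q \<and> range Q = Z"

definition sunny_nonexpansive_retraction ::
    "('a::real_normed_vector \<Rightarrow> 'a) \<Rightarrow> 'a set \<Rightarrow> bool" where
  "sunny_nonexpansive_retraction Q Z \<longleftrightarrow> sunny Q \<and> nonexpansive Q \<and> retraction_onto Q Z"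

end

theory Submission
  imports Defs "HOL-Library.Diagonal_Subsequence"
begin

text \<open>Write \<open>a n\<close> for the distance from \<open>v n\<close> to \<open>Q u\<close>. If \<open>a\<close> fails to drop by a fixed amount along
  a subsequence, uniform convexity forces \<open>v n\<close> to be asymptotically fixed by every resolvent there;
  by demiclosedness all weak cluster points of that subsequence lie in \<open>Z\<close>. The variational
  inequality for \<open>Q\<close> and the weak continuity of the duality mapping \<open>j\<close> then make
  \<open>j (v (Suc n) - Q u) (u - Q u)\<close> asymptotically nonpositive. So at each late step \<open>a\<close> either
  drops by a fixed amount, or is already small, or contracts by the factor \<open>1 - \<xi> n\<close> up to a small
  error, and divergence of the series of \<open>\<xi>\<close> gives \<open>a \<longlonglongrightarrow> 0\<close>. The functionals \<open>j a\<close> norm every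
  point and every best approximation is characterised by them, so neither the Hahn-Banach theorem nor
  reflexivity is needed.\<close>

section \<open>Uniform convexity and weak compactness\<close>

text \<open>Two points of norm at most \<open>d\<close> that are \<open>e\<close> apart force
  \<open>d \<ge> e / 2\<close>, so both can be rescaled to the unit ball, where they stay
  \<open>e / M'\<close> apart and the midpoint estimate applies. One \<open>\<eta>\<close> thus
  serves all radii up to \<open>M\<close> and all weights from \<open>c\<close> on, whatever their
  sum.\<close>

lemma uniformly_convex_combination:
  assumes "uniformly_convex TYPE('a::real_normed_vector)" "e > 0" "c > 0"
  obtains \<eta> where "\<eta> > 0"
    "\<And>d (x::'a) y \<alpha> \<beta>. \<lbrakk>d \<le> M; norm x \<le> d; norm y \<le> d; c \<le> \<alpha>; c \<le> \<beta>; e \<le> norm (x - y)\<rbrakk>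
       \<Longrightarrow> norm (\<alpha> *\<^sub>R x + \<beta> *\<^sub>R y) \<le> (\<alpha> + \<beta>) * d - \<eta>"
proof -
  define M' where "M' = max M 1"
  have M': "M' > 0" "M \<le> M'" by (auto simp: M'_def)
  have "e / M' > 0" using assms M' by simp
  then obtain \<delta> where "\<delta> > 0" and \<delta>: "\<And>x y :: 'a. norm x \<le> 1 \<Longrightarrow> norm y \<le> 1 \<Longrightarrow> norm (x - y) \<ge> e / M'
      \<Longrightarrow> norm ((1 / 2) *\<^sub>R (x + y)) \<le> 1 - \<delta>"
    using assms(1) unfolding uniformly_convex_def by meson
  have one_sided: "norm (\<alpha> *\<^sub>R x + \<beta> *\<^sub>R y) \<le> (\<alpha> + \<beta>) * d - c * \<delta> * e"
    if "d \<le> M" "norm x \<le> d" "norm y \<le> d" "c \<le> \<alpha>" "\<alpha> \<le> \<beta>" "e \<le> norm (x - y)"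
    for d and x y :: 'a and \<alpha> \<beta>
  proof -
    have d2: "e / 2 \<le> d"
      using norm_triangle_ineq4[of x y] that by linarith
    then have d: "d > 0" using assms by linarith
    define x' y' where "x' = (1 / d) *\<^sub>R x" and "y' = (1 / d) *\<^sub>R y"
    have "x' - y' = (1 / d) *\<^sub>R (x - y)" by (simp add: x'_def y'_def scaleR_diff_right)
    then have "norm (x' - y') = norm (x - y) / d" using d by simp
    moreover have "e / M' \<le> norm (x - y) / d"
      using that d M' assms by (intro frac_le) auto
    moreover have "norm x' \<le> 1" "norm y' \<le> 1"
      using that d by (simp_all add: x'_def y'_def)
    ultimately have "norm ((1 / 2) *\<^sub>R (x' + y')) \<le> 1 - \<delta>"
      by (intro \<delta>) auto
    moreover have "x' + y' = (1 / d) *\<^sub>R (x + y)" by (simp add: x'_def y'_def scaleR_add_right)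
    then have "norm ((1 / 2) *\<^sub>R (x' + y')) = norm (x + y) / (2 * d)" using d by simp
    ultimately have "norm (x + y) / (2 * d) \<le> 1 - \<delta>" by simp
    then have xy: "norm (x + y) \<le> 2 * d * (1 - \<delta>)"
      using d pos_divide_le_eq[of "2 * d" "norm (x + y)" "1 - \<delta>"] by (simp add: mult.commute)
    \<comment> \<open>With the smaller weight on the whole sum \<open>x + y\<close>, the midpoint
      estimate saves \<open>\<alpha> * \<delta> * (2 * d)\<close>; the leftover weight sits on
      \<open>y\<close> alone.\<close>
    have "\<alpha> *\<^sub>R x + \<beta> *\<^sub>R y = \<alpha> *\<^sub>R (x + y) + (\<beta> - \<alpha>) *\<^sub>R y"
      by (simp add: algebra_simps)
    then have "norm (\<alpha> *\<^sub>R x + \<beta> *\<^sub>R y) \<le> \<alpha> * norm (x + y) + (\<beta> - \<alpha>) * norm y"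
      using that assms norm_triangle_ineq[of "\<alpha> *\<^sub>R (x + y)" "(\<beta> - \<alpha>) *\<^sub>R y"] by simp
    also have "\<dots> \<le> \<alpha> * (2 * d * (1 - \<delta>)) + (\<beta> - \<alpha>) * d"
      using that assms xy by (intro add_mono mult_left_mono) auto
    also have "\<dots> = (\<alpha> + \<beta>) * d - \<alpha> * \<delta> * (2 * d)" by (simp add: algebra_simps)
    also have "\<dots> \<le> (\<alpha> + \<beta>) * d - c * \<delta> * e"
      using that assms d2 \<open>\<delta> > 0\<close> by (intro diff_left_mono mult_mono) auto
    finally show ?thesis .
  qed
  show thesis
  proof
    show "c * \<delta> * e > 0" using assms \<open>\<delta> > 0\<close> by simp
    fix d and x y :: 'a and \<alpha> \<beta>
    assume *: "d \<le> M" "norm x \<le> d" "norm y \<le> d" "c \<le> \<alpha>" "c \<le> \<beta>" "e \<le> norm (x - y)"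
    show "norm (\<alpha> *\<^sub>R x + \<beta> *\<^sub>R y) \<le> (\<alpha> + \<beta>) * d - c * \<delta> * e"
      using one_sided[of d x y \<alpha> \<beta>] one_sided[of d y x \<beta> \<alpha>] *
      by (cases "\<alpha> \<le> \<beta>") (simp_all add: norm_minus_commute add.commute)
  qed
qed

text \<open>A gap of \<open>e\<close> would cost a fixed \<open>\<eta>\<close> in norm, more than
  the vanishing loss \<open>g n\<close> allows. The arbitrary filter covers constant sequences and
  limits along subsequences alike.\<close>

lemma uniformly_convex_tendsto:
  fixes x y :: "'b \<Rightarrow> 'a::real_normed_vector"
  assumes uc: "uniformly_convex TYPE('a)" and "c > 0"
    and bnd: "\<forall>\<^sub>F n in F. d n \<le> M"
    and xy: "\<forall>\<^sub>F n in F. norm (x n) \<le> d n" "\<forall>\<^sub>F n in F. norm (y n) \<le> d n"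
    and ab: "\<forall>\<^sub>F n in F. c \<le> \<alpha> n" "\<forall>\<^sub>F n in F. c \<le> \<beta> n"
    and lower: "\<forall>\<^sub>F n in F. (\<alpha> n + \<beta> n) * d n - g n \<le> norm (\<alpha> n *\<^sub>R x n + \<beta> n *\<^sub>R y n)"
    and g: "(g \<longlongrightarrow> 0) F"
  shows "((\<lambda>n. x n - y n) \<longlongrightarrow> 0) F"
proof (rule tendstoI)
  fix e :: real assume "e > 0"
  then obtain \<eta> where "\<eta> > 0" and \<eta>: "\<And>d (x::'a) y \<alpha> \<beta>.
      \<lbrakk>d \<le> M; norm x \<le> d; norm y \<le> d; c \<le> \<alpha>; c \<le> \<beta>; e \<le> norm (x - y)\<rbrakk>
       \<Longrightarrow> norm (\<alpha> *\<^sub>R x + \<beta> *\<^sub>R y) \<le> (\<alpha> + \<beta>) * d - \<eta>"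
    using uniformly_convex_combination[OF uc _ \<open>c > 0\<close>] by metis
  have "\<forall>\<^sub>F n in F. g n < \<eta>" using order_tendstoD(2)[OF g \<open>\<eta> > 0\<close>] .
  with bnd xy ab lower show "\<forall>\<^sub>F n in F. dist (x n - y n) 0 < e"
  proof eventually_elim
    case (elim n)
    then show ?case using \<eta>[of "d n" "x n" "y n" "\<alpha> n" "\<beta> n"] by (fastforce simp: not_less)
  qed
qed

section \<open>Points of minimal norm and weakly convergent subsequences\<close>

lemma uniformly_convex_min_norm_unique:
  fixes K :: "'a::real_normed_vector set"
  assumes uc: "uniformly_convex TYPE('a)" and "convex K" "z \<in> K" "z' \<in> K"
    and min: "\<And>y. y \<in> K \<Longrightarrow> norm z \<le> norm y" and eq: "norm z' \<le> norm z"
  shows "z' = z"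
proof -
  \<comment> \<open>The midpoint lies in \<open>K\<close>; constant sequences then turn the limit
    lemma into uniqueness.\<close>
  have "norm z \<le> norm ((1/2) *\<^sub>R z + (1/2) *\<^sub>R z')"
    using assms by (intro min convexD) auto
  then have "((\<lambda>n::nat. z - z') \<longlongrightarrow> 0) sequentially"
    using eq by (intro uniformly_convex_tendsto[OF uc, of "1/2" "\<lambda>_. norm z" "norm z" _ _ _ "\<lambda>_. 1/2" "\<lambda>_. 1/2" "\<lambda>_. 0"]) auto
  then show ?thesis by (simp add: LIMSEQ_const_iff)
qed

text \<open>Almost minimal points of late sets have their midpoint in an earlier set
  \<open>K N\<close>, whose distance from 0 is already close to the limit \<open>D\<close> of all
  distances, so uniform convexity makes them a Cauchy sequence. This stands in for weak compactness;
  with a constant \<open>K\<close> it gives best approximations.\<close>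

lemma uniformly_convex_nested_min_norm:
  fixes K :: "nat \<Rightarrow> 'a::banach set"
  assumes uc: "uniformly_convex TYPE('a)"
    and closed: "\<And>n. closed (K n)" and convex: "\<And>n. convex (K n)" and "decseq K"
    and bnd: "\<And>n. \<exists>y\<in>K n. norm y \<le> M"
  obtains z where "z \<in> (\<Inter>n. K n)" "\<And>y. y \<in> (\<Inter>n. K n) \<Longrightarrow> norm z \<le> norm y"
proof -
  define d where "d n = infdist 0 (K n)" for n
  have ne: "K n \<noteq> {}" for n using bnd by blast
  have dle: "d n \<le> norm y" if "y \<in> K n" for n y
    using infdist_le[OF that, of 0] by (simp add: d_def)
  have mono: "K n \<subseteq> K m" if "m \<le> n" for m n using \<open>decseq K\<close> that by (simp add: decseq_def)
  have "incseq d"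
    unfolding d_def incseq_def by (intro allI impI infdist_mono mono ne)
  have dM: "d n \<le> M" for n using bnd[of n] dle[of _ n] by force
  obtain D where D: "d \<longlonglongrightarrow> D" "\<And>n. d n \<le> D"
    using incseq_convergent[OF \<open>incseq d\<close>] dM by metis
  have "\<exists>y\<in>K n. norm y < d n + 1 / Suc n" for n
  proof -
    have "Inf (dist 0 ` K n) < d n + 1 / Suc n" using ne by (simp add: d_def infdist_def)
    then show ?thesis using cInf_lessD[of "dist 0 ` K n"] ne by fastforce
  qed
  then obtain x where x: "\<And>n. x n \<in> K n" "\<And>n. norm (x n) < d n + 1 / Suc n" by metis
  have "Cauchy x"
  proof (rule metric_CauchyI)
    fix e :: real assume "e > 0"
    obtain \<eta> where "\<eta> > 0" and \<eta>: "\<And>d (x::'a) y \<alpha> \<beta>.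
      \<lbrakk>d \<le> D + 1; norm x \<le> d; norm y \<le> d; 1/2 \<le> \<alpha>; 1/2 \<le> \<beta>; e \<le> norm (x - y)\<rbrakk>
       \<Longrightarrow> norm (\<alpha> *\<^sub>R x + \<beta> *\<^sub>R y) \<le> (\<alpha> + \<beta>) * d - \<eta>"
      using uniformly_convex_combination[OF uc \<open>e > 0\<close>, of "1/2" "D + 1"] by auto
    \<comment> \<open>\<open>N\<close> is chosen so that the radius \<open>D + 1 / Suc N\<close>,
      lowered by \<open>\<eta>\<close>, falls below \<open>d N\<close>.\<close>
    have "(\<lambda>n. d n - 1 / Suc n) \<longlonglongrightarrow> D - 0"
      by (intro tendsto_diff D LIMSEQ_Suc[OF lim_1_over_n])
    then have "\<forall>\<^sub>F n in sequentially. d n - 1 / Suc n > D - \<eta> / 2"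
      by (intro order_tendstoD) (use \<open>\<eta> > 0\<close> in auto)
    then obtain N where N: "d N - 1 / Suc N > D - \<eta> / 2" by (auto simp: eventually_sequentially)
    have "dist (x m) (x n) < e" if "m \<ge> N" "n \<ge> N" for m n
    proof (rule ccontr)
      assume "\<not> dist (x m) (x n) < e"
      then have ge: "e \<le> norm (x m - x n)" by (simp add: dist_norm)
      have upper: "norm (x k) \<le> D + 1 / Suc N" if "k \<ge> N" for k
      proof -
        have "1 / real (Suc k) \<le> 1 / Suc N" using that by (simp add: divide_simps)
        then show ?thesis using x(2)[of k] D(2)[of k] by linarith
      qed
      have "norm ((1/2) *\<^sub>R x m + (1/2) *\<^sub>R x n) \<le> (1/2 + 1/2) * (D + 1 / Suc N) - \<eta>"
        using upper that ge by (intro \<eta>) auto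
      moreover have "(1/2) *\<^sub>R x m + (1/2) *\<^sub>R x n \<in> K N"
        using x(1)[of m] x(1)[of n] mono that by (intro convexD[OF convex]) auto
      then have "d N \<le> norm ((1/2) *\<^sub>R x m + (1/2) *\<^sub>R x n)" by (rule dle)
      ultimately show False using N \<open>\<eta> > 0\<close> by simp
    qed
    then show "\<exists>N. \<forall>m\<ge>N. \<forall>n\<ge>N. dist (x m) (x n) < e" by blast
  qed
  then obtain z where z: "x \<longlonglongrightarrow> z" using Cauchy_convergent_iff convergent_def by blast
  show thesis
  proof
    show "z \<in> (\<Inter>n. K n)"
    proof safe
      fix n
      have "\<forall>\<^sub>F m in sequentially. x m \<in> K n"
        unfolding eventually_sequentially using x(1) mono by blast
      then show "z \<in> K n"
        by (rule Lim_in_closed_set[OF closed _ _ z]) simp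
    qed
    fix y assume y: "y \<in> (\<Inter>n. K n)"
    have lim: "(\<lambda>n. norm y + 1 / Suc n) \<longlonglongrightarrow> norm y + 0"
      by (intro tendsto_intros LIMSEQ_Suc[OF lim_1_over_n])
    have "norm (x n) \<le> norm y + 1 / Suc n" for n
    proof -
      have "d n \<le> norm y" using y by (intro dle) blast
      then show ?thesis using x(2)[of n] by linarith
    qed
    then show "norm z \<le> norm y" using LIMSEQ_le[OF tendsto_norm[OF z] lim] by simp
  qed
qed

text \<open>A diagonal argument selects a subsequence \<open>D\<close> for which the minimal norm of \<open>K\<close>, the
  intersection of the closed convex hulls of the tails, no longer grows under further thinning. The
  minimal point of \<open>K\<close> is then common to all further subsequences, hence a weak limit.\<close>

lemma uniformly_convex_weakly_convergent_subsequence: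
  fixes x :: "nat \<Rightarrow> 'a::banach"
  assumes uc: "uniformly_convex TYPE('a)" and bnd: "bounded (range x)"
  obtains s z where "strict_mono s" "weakly_converges (x \<circ> s) z"
proof -
  obtain M where M: "\<And>n. norm (x n) \<le> M" using bnd by (auto simp: bounded_iff)
  define H where "H s n = closure (convex hull ((x \<circ> s) ` {n..}))" for s :: "nat \<Rightarrow> nat" and n
  define K where "K s = (\<Inter>n. H s n)" for s
  have H_mono: "H (s \<circ> t) n \<subseteq> H s n" if "strict_mono t" for s t :: "nat \<Rightarrow> nat" and n
  proof -
    have "(x \<circ> (s \<circ> t)) ` {n..} \<subseteq> (x \<circ> s) ` {n..}"
    proof safe
      fix k assume "n \<le> k"
      then have "n \<le> t k" using strict_mono_imp_increasing[OF that, of k] by linarith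
      then show "(x \<circ> (s \<circ> t)) k \<in> (x \<circ> s) ` {n..}" by (intro image_eqI[of _ _ "t k"]) auto
    qed
    then show ?thesis unfolding H_def by (intro closure_mono hull_mono)
  qed
  have K_mono: "K (s \<circ> t) \<subseteq> K s" if "strict_mono t" for s t :: "nat \<Rightarrow> nat"
    unfolding K_def using H_mono[OF that] by blast
  have H_dec: "H s n \<subseteq> H s m" if "m \<le> n" for s m n
    unfolding H_def using that by (intro closure_mono hull_mono) auto
  \<comment> \<open>The diagonal subsequence will be known to satisfy \<open>P k\<close> after its
    first \<open>Suc k\<close> terms are dropped; by this inclusion the dropping does not raise the
    minimal norm.\<close>
  have K_shift: "K s \<subseteq> K (s \<circ> (+) m)" for s m
  proof -
    have "H s (n + m) \<subseteq> H (s \<circ> (+) m) n" for n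
    proof -
      have "(x \<circ> s) ` {n + m..} \<subseteq> (x \<circ> (s \<circ> (+) m)) ` {n..}"
      proof safe
        fix k assume "n + m \<le> k"
        then show "(x \<circ> s) k \<in> (x \<circ> (s \<circ> (+) m)) ` {n..}" by (intro image_eqI[of _ _ "k - m"]) auto
      qed
      then show ?thesis unfolding H_def by (intro closure_mono hull_mono)
    qed
    then show ?thesis unfolding K_def by blast
  qed
  have "\<exists>z\<in>K s. \<forall>y\<in>K s. norm z \<le> norm y" for s
  proof (rule uniformly_convex_nested_min_norm[OF uc, of "H s" M])
    show "\<And>n. closed (H s n)" "\<And>n. convex (H s n)"
      by (auto simp: H_def intro: convex_closure)
    show "decseq (H s)" using H_dec by (auto simp: decseq_def)
    fix n
    have "x (s n) \<in> H s n" unfolding H_def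
      by (intro subsetD[OF closure_subset] hull_inc) auto
    then show "\<exists>y\<in>H s n. norm y \<le> M" using M by blast
  qed (unfold K_def, blast)
  then obtain \<mu> where \<mu>: "\<And>s. \<mu> s \<in> K s" "\<And>s y. y \<in> K s \<Longrightarrow> norm (\<mu> s) \<le> norm y" by metis
  have K_bnd: "norm y \<le> M" if "y \<in> K s" for s y
  proof -
    have "H s 0 \<subseteq> cball 0 M"
      unfolding H_def using M by (intro closure_minimal hull_minimal) auto
    then show ?thesis using that by (auto simp: K_def)
  qed
  define \<rho> where "\<rho> s = norm (\<mu> s)" for s
  have \<rho>_mono: "\<rho> s \<le> \<rho> s'" if "K s' \<subseteq> K s" for s s'
    using \<mu> that by (auto simp: \<rho>_def)
  have \<rho>_sub: "\<rho> s \<le> \<rho> (s \<circ> t)" if "strict_mono t" for s t :: "nat \<Rightarrow> nat"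
    by (intro \<rho>_mono K_mono that)
  define P where "P k s \<longleftrightarrow> (\<forall>t. strict_mono t \<longrightarrow> \<rho> (s \<circ> t) \<le> \<rho> s + 1 / Suc k)" for k and s :: "nat \<Rightarrow> nat"
  have P_ex: "\<exists>t. strict_mono t \<and> P k (s \<circ> t)" for k and s :: "nat \<Rightarrow> nat"
  proof -
    \<comment> \<open>Thinning raises \<open>\<rho>\<close> at most up to \<open>M\<close>, so some
      thinning comes within \<open>1 / Suc k\<close> of the supremum, and no later one gains more
      than that.\<close>
    define S where "S = {\<rho> (s \<circ> t) | t. strict_mono t}"
    have bdd: "bdd_above S" unfolding S_def bdd_above_def using \<mu>(1) K_bnd by (auto simp: \<rho>_def)
    have "\<rho> s \<in> S" unfolding S_def
      by (intro CollectI exI[of _ "\<lambda>n. n"]) (simp add: comp_def strict_mono_def)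
    then have "S \<noteq> {}" by blast
    have "Sup S - 1 / Suc k < Sup S" by simp
    then have "\<exists>y\<in>S. Sup S - 1 / Suc k < y"
      using less_cSupD[OF \<open>S \<noteq> {}\<close>] by metis
    then obtain t where t: "strict_mono t" "Sup S - 1 / Suc k < \<rho> (s \<circ> t)" by (auto simp: S_def)
    have "\<rho> (s \<circ> t \<circ> t') \<le> \<rho> (s \<circ> t) + 1 / Suc k" if "strict_mono t'" for t'
    proof -
      have "\<rho> (s \<circ> t \<circ> t') \<in> S" unfolding S_def using t that
        by (auto simp: comp_assoc intro!: exI[of _ "t \<circ> t'"] strict_mono_o)
      then have "\<rho> (s \<circ> t \<circ> t') \<le> Sup S" by (intro cSup_upper bdd)
      then show ?thesis using t by linarith
    qed
    then show ?thesis using t by (auto simp: P_def)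
  qed
  have P_sub: "P k (s \<circ> t)" if "P k s" "strict_mono t" for k and s t :: "nat \<Rightarrow> nat"
    unfolding P_def
  proof (intro allI impI)
    fix t' :: "nat \<Rightarrow> nat" assume "strict_mono t'"
    then have "\<rho> (s \<circ> (t \<circ> t')) \<le> \<rho> s + 1 / Suc k"
      using that by (auto simp: P_def intro!: strict_mono_o)
    then show "\<rho> (s \<circ> t \<circ> t') \<le> \<rho> (s \<circ> t) + 1 / Suc k"
      using \<rho>_sub[OF that(2), of s] by (simp add: comp_assoc)
  qed
  interpret subseqs P
    using P_ex by unfold_locales
  define D where "D = diagseq"
  have D: "strict_mono D" unfolding D_def by (rule subseq_diagseq)
  have P_D: "P k (D \<circ> (+) (Suc k))" for k
    unfolding D_def by (rule diagseq_holds) (rule P_sub)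
  have stable: "\<mu> D \<in> K (D \<circ> t)" if t: "strict_mono t" for t :: "nat \<Rightarrow> nat"
  proof -
    have "\<rho> (D \<circ> t) \<le> \<rho> D + 1 / Suc k" for k
    proof -
      \<comment> \<open>From index \<open>Suc k\<close> on, \<open>D \<circ> t\<close> is a thinning
        of \<open>D \<circ> (+) (Suc k)\<close> by \<open>t'\<close>, which makes \<open>P_D\<close>
        applicable.\<close>
      define t' where "t' i = t (Suc k + i) - Suc k" for i
      have ge: "Suc k + i \<le> t (Suc k + i)" for i using strict_mono_imp_increasing[OF t] .
      have "strict_mono t'"
        unfolding strict_mono_def t'_def
      proof (intro allI impI)
        fix i j :: nat assume "i < j"
        then have "t (Suc k + i) < t (Suc k + j)" using t by (simp add: strict_mono_def)
        then show "t (Suc k + i) - Suc k < t (Suc k + j) - Suc k" using ge[of i] by linarith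
      qed
      then have "\<rho> (D \<circ> (+) (Suc k) \<circ> t') \<le> \<rho> (D \<circ> (+) (Suc k)) + 1 / Suc k"
        using P_D by (simp add: P_def)
      moreover have "D \<circ> (+) (Suc k) \<circ> t' = D \<circ> t \<circ> (+) (Suc k)"
      proof -
        have "Suc k + (t (Suc k + i) - Suc k) = t (Suc k + i)" for i using ge[of i] by linarith
        then show ?thesis by (simp only: comp_def t'_def)
      qed
      moreover have "\<rho> (D \<circ> t) \<le> \<rho> (D \<circ> t \<circ> (+) (Suc k))"
        by (intro \<rho>_sub) (simp add: strict_mono_def)
      moreover have "\<rho> (D \<circ> (+) (Suc k)) \<le> \<rho> D" by (intro \<rho>_mono K_shift)
      ultimately show ?thesis by simp
    qed
    moreover have lim: "(\<lambda>k. \<rho> D + 1 / Suc k) \<longlonglongrightarrow> \<rho> D + 0"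
      by (intro tendsto_intros LIMSEQ_Suc[OF lim_1_over_n])
    ultimately have "\<rho> (D \<circ> t) \<le> \<rho> D"
      using LIMSEQ_le_const[OF lim] by simp
    moreover have "convex (K D)" unfolding K_def H_def
      by (intro convex_INT convex_closure convex_convex_hull)
    \<comment> \<open>The minimal point of \<open>K (D \<circ> t)\<close> lies in \<open>K D\<close>
      with norm no larger than the minimum there, so it is the unique minimal point of
      \<open>K D\<close>.\<close>
    ultimately have "\<mu> (D \<circ> t) = \<mu> D"
      using \<mu> subsetD[OF K_mono[OF t, of D]]
      by (intro uniformly_convex_min_norm_unique[OF uc, of "K D"]) (auto simp: \<rho>_def)
    then show ?thesis using \<mu>(1) by metis
  qed
  have one_sided: "\<forall>\<^sub>F n in sequentially. f (x (D n)) < f (\<mu> D) + e"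
    if "e > 0" for f :: "'a \<Rightarrow>\<^sub>L real" and e
  proof (rule ccontr)
    assume "\<not> ?thesis"
    \<comment> \<open>A subsequence on which \<open>f\<close> stays above
      \<open>f (\<mu> D) + e\<close> has its closed convex hull in that half-space, yet stability
      puts \<open>\<mu> D\<close> into this hull.\<close>
    then have "\<exists>\<^sub>F n in sequentially. f (\<mu> D) + e \<le> f (x (D n))"
      by (simp add: not_eventually not_less)
    then have "infinite {n. f (\<mu> D) + e \<le> f (x (D n))}"
      unfolding cofinite_eq_sequentially[symmetric] frequently_cofinite .
    then obtain t :: "nat \<Rightarrow> nat" where t: "strict_mono t" "\<And>n. f (\<mu> D) + e \<le> f (x (D (t n)))"
      using infinite_enumerate[of "{n. f (\<mu> D) + e \<le> f (x (D n))}"] by auto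
    have "H (D \<circ> t) 0 \<subseteq> {y. f (\<mu> D) + e \<le> f y}"
      unfolding H_def
    proof (intro closure_minimal hull_minimal)
      show "closed {y. f (\<mu> D) + e \<le> f y}" by (intro closed_Collect_le continuous_intros)
      show "convex {y. f (\<mu> D) + e \<le> f y}"
      proof (rule convexI)
        fix y y' and a b :: real
        assume *: "y \<in> {y. f (\<mu> D) + e \<le> f y}" "y' \<in> {y. f (\<mu> D) + e \<le> f y}" "0 \<le> a" "0 \<le> b" "a + b = 1"
        have "f (\<mu> D) + e = a * (f (\<mu> D) + e) + b * (f (\<mu> D) + e)"
          using * by (simp flip: distrib_right)
        also have "\<dots> \<le> a * f y + b * f y'" using * by (intro add_mono mult_left_mono) auto
        finally show "a *\<^sub>R y + b *\<^sub>R y' \<in> {y. f (\<mu> D) + e \<le> f y}"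
          by (simp add: blinfun.add_right blinfun.scaleR_right)
      qed
    qed (use t in auto)
    then show False using stable[OF t(1)] \<open>e > 0\<close> by (auto simp: K_def)
  qed
  have "weakly_converges (x \<circ> D) (\<mu> D)"
    unfolding weakly_converges_def
  proof (intro allI tendstoI)
    fix f :: "'a \<Rightarrow>\<^sub>L real" and e :: real assume "e > 0"
    from one_sided[OF this, of f] one_sided[OF this, of "- f"]
    show "\<forall>\<^sub>F n in sequentially. dist (f ((x \<circ> D) n)) (f (\<mu> D)) < e"
      by eventually_elim (auto simp: dist_real_def blinfun.minus_left)
  qed
  with D show thesis by (rule that)
qed

section \<open>Accretive operators and resolvents\<close>

text \<open>The functional from accretivity norms \<open>x - y\<close> and is nonnegative on
  \<open>a - b\<close>, so its value at \<open>x - y + s *\<^sub>R (a - b)\<close> is at least the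
  square of \<open>norm (x - y)\<close>. Accretivity enters everything below only through this
  inequality.\<close>

lemma accretive_norm_le:
  assumes "accretive A" "a \<in> A x" "b \<in> A y" "s \<ge> 0"
  shows "norm (x - y) \<le> norm (x - y + s *\<^sub>R (a - b))"
proof (cases "x = y")
  case False
  have "x \<in> op_domain A" "y \<in> op_domain A" using assms by (auto simp: op_domain_def)
  then obtain j where j: "j \<in> normalized_duality_map (x - y)" "blinfun_apply j (a - b) \<ge> 0"
    using assms unfolding accretive_def by blast
  then have nj: "norm j = norm (x - y)" "blinfun_apply j (x - y) = norm (x - y) * norm j"
    by (auto simp: duality_map_def)
  have "norm (x - y) * norm (x - y) = blinfun_apply j (x - y)" using nj by simp
  also have "\<dots> \<le> blinfun_apply j (x - y + s *\<^sub>R (a - b))"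
    using j assms by (simp add: blinfun.add_right blinfun.scaleR_right)
  also have "\<dots> \<le> norm j * norm (x - y + s *\<^sub>R (a - b))"
    using norm_blinfun[of j "x - y + s *\<^sub>R (a - b)"] by simp
  finally have "norm (x - y) * norm (x - y) \<le> norm (x - y) * norm (x - y + s *\<^sub>R (a - b))"
    using nj by simp
  then show ?thesis using False by simp
qed simp

text \<open>Two preimages of \<open>x\<close> make the right-hand side of
  \<open>accretive_norm_le\<close> vanish, which justifies the definite description in
  \<open>resolvent\<close>.\<close>

lemma resolvent_eqI:
  assumes "accretive A" "s > 0" "a \<in> A y" "x = y + s *\<^sub>R a"
  shows "resolvent s A x = y"
  unfolding resolvent_def
proof (rule the_equality)
  show "y \<in> op_inverse (id_plus s A) x" using assms by (auto simp: op_inverse_def id_plus_def)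
  fix y' assume "y' \<in> op_inverse (id_plus s A) x"
  then obtain a' where a': "a' \<in> A y'" "x = y' + s *\<^sub>R a'" by (auto simp: op_inverse_def id_plus_def)
  have "y' - y + s *\<^sub>R (a' - a) = 0" using assms(4) a'(2) by (simp add: algebra_simps)
  then show "y' = y" using accretive_norm_le[OF assms(1) a'(1) assms(3), of s] assms(2) by simp
qed

text \<open>The quotient is the Yosida approximation of \<open>A\<close> at \<open>x\<close>; it
  supplies the graph elements fed into \<open>accretive_norm_le\<close>.\<close>

lemma resolvent_in:
  assumes "accretive A" "s > 0" "x \<in> op_range (id_plus s A)"
  shows "(x - resolvent s A x) /\<^sub>R s \<in> A (resolvent s A x)"
proof -
  obtain y a where ya: "a \<in> A y" "x = y + s *\<^sub>R a"
    using assms(3) by (auto simp: op_range_def id_plus_def)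
  then have "resolvent s A x = y" using assms by (intro resolvent_eqI)
  with ya assms(2) show ?thesis by simp
qed

lemma resolvent_nonexpansive:
  assumes "accretive A" "s > 0" "x \<in> op_range (id_plus s A)" "y \<in> op_range (id_plus s A)"
  shows "norm (resolvent s A x - resolvent s A y) \<le> norm (x - y)"
proof -
  let ?x = "resolvent s A x" and ?y = "resolvent s A y"
  have "?x - ?y + s *\<^sub>R ((x - ?x) /\<^sub>R s - (y - ?y) /\<^sub>R s) = x - y"
    using assms(2) by (simp add: scaleR_diff_right)
  then show ?thesis
    using accretive_norm_le[OF assms(1) resolvent_in[OF assms(1-3)] resolvent_in[OF assms(1,2,4)], of s]
      assms(2) by simp
qed

text \<open>The step \<open>s/2\<close> in place of \<open>s\<close> moves the resolvent value
  halfway back to \<open>x\<close>. This gives the lower bound on a midpoint that uniform convexity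
  asks for.\<close>

lemma resolvent_dist_zero_midpoint:
  assumes "accretive A" "s > 0" "x \<in> op_range (id_plus s A)" "0 \<in> A p"
  shows "norm (resolvent s A x - p) \<le> norm ((1/2) *\<^sub>R (x - p) + (1/2) *\<^sub>R (resolvent s A x - p))"
proof -
  let ?x = "resolvent s A x"
  have "?x - p + (s/2) *\<^sub>R ((x - ?x) /\<^sub>R s - 0) = ?x - p + (1/2) *\<^sub>R (x - ?x)"
    using assms(2) by simp
  also have "\<dots> = (1/2) *\<^sub>R (x - p) + (1/2) *\<^sub>R (?x - p)"
    by (simp add: algebra_simps flip: scaleR_add_left)
  finally show ?thesis
    using accretive_norm_le[OF assms(1) resolvent_in[OF assms(1-3)] assms(4), of "s/2"] assms(2) by simp
qed

lemma resolvent_dist_zero: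
  assumes "accretive A" "s > 0" "x \<in> op_range (id_plus s A)" "0 \<in> A p"
  shows "norm (resolvent s A x - p) \<le> norm (x - p)"
  using accretive_norm_le[OF assms(1) resolvent_in[OF assms(1-3)] assms(4), of s] assms(2) by simp

text \<open>In \<open>accretive_norm_le\<close> with step \<open>t\<close> the resolvent of
  \<open>y\<close> cancels, as \<open>t\<close> times its Yosida quotient is \<open>y\<close> minus
  the resolvent value; only \<open>x - y\<close> and multiples of \<open>x - resolvent s A x\<close>
  remain. A point almost fixed at parameter \<open>s\<close> is thereby controlled at another
  parameter \<open>t\<close>.\<close>

lemma resolvent_dist_resolvent:
  assumes "accretive A" "s > 0" "x \<in> op_range (id_plus s A)" "t > 0" "y \<in> op_range (id_plus t A)"
  shows "norm (x - resolvent t A y) \<le> norm (x - y) + (2 + t / s) * norm (x - resolvent s A x)"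
proof -
  let ?x = "resolvent s A x" and ?y = "resolvent t A y"
  have "norm (?x - ?y) \<le> norm (?x - ?y + t *\<^sub>R ((x - ?x) /\<^sub>R s - (y - ?y) /\<^sub>R t))"
    using assms by (intro accretive_norm_le[of A] resolvent_in) auto
  also have "?x - ?y + t *\<^sub>R ((x - ?x) /\<^sub>R s - (y - ?y) /\<^sub>R t) = (x - y) + (?x - x) + (t / s) *\<^sub>R (x - ?x)"
    using assms by (simp add: scaleR_diff_right divide_inverse)
  also have "norm \<dots> \<le> norm (x - y) + norm (x - ?x) + (t / s) * norm (x - ?x)"
    using assms norm_triangle_ineq[of "x - y + (?x - x)" "(t / s) *\<^sub>R (x - ?x)"]
      norm_triangle_ineq[of "x - y" "?x - x"] by (simp add: norm_minus_commute)
  finally have "norm (?x - ?y) \<le> norm (x - y) + norm (x - ?x) + (t / s) * norm (x - ?x)" .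
  moreover have "norm (x - ?y) \<le> norm (x - ?x) + norm (?x - ?y)"
    using norm_triangle_ineq[of "x - ?x" "?x - ?y"] by simp
  ultimately show ?thesis by (simp add: algebra_simps)
qed

section \<open>The duality mapping\<close>

locale weakly_continuous_duality =
  fixes \<psi> :: "real \<Rightarrow> real" and j :: "'a::banach \<Rightarrow> ('a \<Rightarrow>\<^sub>L real)"
  assumes uc: "uniformly_convex TYPE('a)"
    and gauge: "gauge_function \<psi>"
    and duality: "\<And>a. duality_map \<psi> a = {j a}"
    and weak_continuous: "\<And>x l. weakly_converges x l \<Longrightarrow> weak_star_converges (\<lambda>n. j (x n)) (j l)"
begin

lemma norm_j: "norm (j a) = \<psi> (norm a)" and j_self: "j a a = norm a * \<psi> (norm a)"
proof -
  have "j a \<in> duality_map \<psi> a" by (simp add: duality)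
  then show "norm (j a) = \<psi> (norm a)" "j a a = norm a * \<psi> (norm a)"
    by (auto simp: duality_map_def)
qed

lemma gauge_zero: "\<psi> 0 = 0"
  using gauge by (simp add: gauge_function_def)

lemma gauge_less: "0 \<le> s \<Longrightarrow> s < t \<Longrightarrow> \<psi> s < \<psi> t"
  using gauge by (auto simp: gauge_function_def intro: strict_mono_onD)

lemma gauge_pos: "0 < t \<Longrightarrow> 0 < \<psi> t"
  using gauge_less[of 0 t] gauge_zero by simp

lemma j_le: "j a b \<le> \<psi> (norm a) * norm b"
  using norm_blinfun[of "j a" b] by (simp add: norm_j)

lemma weakly_converges_norm: "x \<longlonglongrightarrow> l \<Longrightarrow> weakly_converges x l"
  unfolding weakly_converges_def by (auto intro: blinfun.tendsto)

text \<open>First-order condition, standing in for differentiability of the norm. Each displaced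
  point \<open>x n\<close> is normed by \<open>j (x n)\<close> and is no shorter than
  \<open>a\<close>, so \<open>j (x n)\<close> is nonpositive on \<open>b\<close>; the sign passes to
  \<open>j a\<close> by continuity.\<close>

lemma j_nonpos:
  assumes le: "\<And>t. 0 < t \<Longrightarrow> t < 1 \<Longrightarrow> norm a \<le> norm (a - t *\<^sub>R b)"
  shows "j a b \<le> 0"
proof -
  \<comment> \<open>The double \<open>Suc\<close> keeps the step length below 1 already at
    \<open>n = 0\<close>.\<close>
  define x where "x n = a - (1 / real (Suc (Suc n))) *\<^sub>R b" for n
  have "(\<lambda>n. a - (1 / real (Suc (Suc n))) *\<^sub>R b) \<longlonglongrightarrow> a - 0 *\<^sub>R b"
    by (intro tendsto_intros LIMSEQ_Suc[OF LIMSEQ_Suc[OF lim_1_over_n]])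
  then have "x \<longlonglongrightarrow> a" unfolding x_def[abs_def] by simp
  then have "(\<lambda>n. j (x n) b) \<longlonglongrightarrow> j a b"
    using weak_continuous[OF weakly_converges_norm] by (simp add: weak_star_converges_def)
  moreover have "j (x n) b \<le> 0" for n
  proof -
    let ?t = "1 / real (Suc (Suc n))"
    have "norm a \<le> norm (x n)" unfolding x_def by (intro le) auto
    then have "j (x n) a \<le> j (x n) (x n)"
      using j_le[of "x n" a] gauge_pos[of "norm (x n)"]
      by (cases "x n = 0") (auto simp: j_self gauge_zero mult.commute intro: order_trans mult_right_mono)
    also have "\<dots> = j (x n) a - ?t * j (x n) b"
      by (subst (2) x_def) (simp add: blinfun.diff_right blinfun.scaleR_right)
    finally show ?thesis by (simp add: divide_simps)
  qed
  ultimately show ?thesis by (intro LIMSEQ_le_const2) auto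
qed

text \<open>Mazur's theorem by way of the point \<open>p\<close> of \<open>C\<close> nearest to
  \<open>z\<close>: the condition \<open>j (z - p) (x n - p) \<le> 0\<close> survives the weak
  limit, so it holds for \<open>z\<close> itself and gives \<open>z = p\<close>.\<close>

lemma weakly_closed:
  fixes C :: "'a set"
  assumes "closed C" "convex C" "\<And>n. x n \<in> C" "weakly_converges x z"
  shows "z \<in> C"
proof -
  define K where "K = (\<lambda>c. c - z) ` C"
  have K: "closed K" "convex K" unfolding K_def using assms
    by (simp_all add: closed_translation_subtract convex_translation_subtract)
  have x0: "x 0 - z \<in> K" unfolding K_def using assms(3) by blast
  obtain k where "k \<in> (\<Inter>n::nat. K)" "\<And>y. y \<in> (\<Inter>n::nat. K) \<Longrightarrow> norm k \<le> norm y"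
    by (rule uniformly_convex_nested_min_norm[OF uc, of "\<lambda>_. K" "norm (x 0 - z)"])
       (use K x0 in \<open>auto simp: decseq_def\<close>)
  then have k: "k \<in> K" "\<And>y. y \<in> K \<Longrightarrow> norm k \<le> norm y" by auto
  from k(1) obtain p where p: "p \<in> C" "k = p - z" unfolding K_def by blast
  have nearest: "norm (z - p) \<le> norm (z - c)" if "c \<in> C" for c
    using k(2)[of "c - z"] that p by (auto simp: K_def norm_minus_commute)
  have "j (z - p) (x n - p) \<le> 0" for n
  proof (rule j_nonpos)
    fix t :: real assume "0 < t" "t < 1"
    then have "(1 - t) *\<^sub>R p + t *\<^sub>R x n \<in> C" using assms p by (intro convexD) auto
    from nearest[OF this] show "norm (z - p) \<le> norm (z - p - t *\<^sub>R (x n - p))"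
      by (simp add: algebra_simps)
  qed
  moreover have "(\<lambda>n. j (z - p) (x n) - j (z - p) p) \<longlonglongrightarrow> j (z - p) z - j (z - p) p"
    using assms(4) by (intro tendsto_diff) (auto simp: weakly_converges_def)
  ultimately have "j (z - p) (z - p) \<le> 0"
    by (intro LIMSEQ_le_const2[of "\<lambda>n. j (z - p) (x n) - j (z - p) p"])
       (auto simp: blinfun.diff_right)
  then have "z = p" using gauge_pos[of "norm (z - p)"]
    by (cases "z = p") (auto simp: j_self mult_le_0_iff not_le)
  with p show ?thesis by simp
qed

text \<open>If \<open>y \<noteq> z\<close>, uniform convexity would bring the midpoint of \<open>y\<close> and \<open>z\<close> strictly closer to
  \<open>x n\<close> than \<open>z\<close> is, while \<open>j (x n - z) \<longlonglongrightarrow> 0\<close> weakly* forbids this.\<close>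

lemma Opial:
  fixes x :: "nat \<Rightarrow> 'a"
  assumes weak: "weakly_converges x z" and bnd: "\<And>n. norm (x n - z) \<le> M"
    and le: "\<And>n. norm (x n - y) \<le> norm (x n - z) + g n" and g: "g \<longlonglongrightarrow> 0"
  shows "y = z"
proof (rule ccontr)
  assume "y \<noteq> z"
  define e where "e = norm (y - z)"
  have "e > 0" using \<open>y \<noteq> z\<close> by (simp add: e_def)
  \<comment> \<open>\<open>h n\<close> will bound the norm lost in passing from
    \<open>x n - z\<close> to the midpoint. As \<open>y\<close> and \<open>z\<close> are
    \<open>e\<close> apart and \<open>y\<close> is hardly further from \<open>x n\<close> than
    \<open>z\<close> is, eventually \<open>norm (x n - z) > e / 4\<close>, which allows the fixed
    divisor.\<close>
  define h where "h n = \<bar>j (x n - z) ((1/2) *\<^sub>R (y - z))\<bar> / \<psi> (e/4)" for n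
  have "weakly_converges (\<lambda>n. x n - z) 0"
    using weak unfolding weakly_converges_def
    by (auto simp: blinfun.diff_right LIM_zero)
  then have "(\<lambda>n. j (x n - z) ((1/2) *\<^sub>R (y - z))) \<longlonglongrightarrow> j 0 ((1/2) *\<^sub>R (y - z))"
    using weak_continuous by (simp add: weak_star_converges_def)
  moreover have "j 0 = 0" using norm_j[of 0] by (simp add: gauge_zero)
  ultimately have h: "h \<longlonglongrightarrow> 0"
    unfolding h_def[abs_def] by (intro tendsto_divide_zero tendsto_rabs_zero) simp
  have "\<forall>\<^sub>F n in sequentially. \<bar>g n\<bar> < min 1 (e/4)"
    using order_tendstoD(2)[OF tendsto_rabs_zero[OF g], of "min 1 (e/4)"] \<open>e > 0\<close> by simp
  then have ev: "\<forall>\<^sub>F n in sequentially. \<bar>g n\<bar> < 1 \<and> \<bar>g n\<bar> < e/4" by simp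
  have "((\<lambda>n. (x n - y) - (x n - z)) \<longlongrightarrow> 0) sequentially"
  proof (rule uniformly_convex_tendsto[OF uc, of "1/2" "\<lambda>n. norm (x n - z) + \<bar>g n\<bar>" "M + 1"
        _ _ _ "\<lambda>_. 1/2" "\<lambda>_. 1/2" "\<lambda>n. \<bar>g n\<bar> + h n"])
    show "\<forall>\<^sub>F n in sequentially. norm (x n - z) + \<bar>g n\<bar> \<le> M + 1"
      using ev by eventually_elim (use bnd in \<open>force intro: add_mono\<close>)
    show "\<forall>\<^sub>F n in sequentially. norm (x n - y) \<le> norm (x n - z) + \<bar>g n\<bar>"
      by (intro always_eventually allI order_trans[OF le]) simp
    show "\<forall>\<^sub>F n in sequentially. (1/2 + 1/2) * (norm (x n - z) + \<bar>g n\<bar>) - (\<bar>g n\<bar> + h n)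
      \<le> norm ((1/2) *\<^sub>R (x n - y) + (1/2) *\<^sub>R (x n - z))"
      using ev
    proof eventually_elim
      case (elim n)
      let ?a = "x n - z" and ?m = "(1/2) *\<^sub>R (x n - y) + (1/2) *\<^sub>R (x n - z)"
      have "e \<le> norm (x n - y) + norm (x n - z)"
        using norm_triangle_ineq4[of "x n - z" "x n - y"] by (simp add: e_def)
      then have "e / 4 < norm ?a" using le[of n] elim \<open>e > 0\<close> by linarith
      then have pos: "0 < \<psi> (e/4)" "\<psi> (e/4) \<le> \<psi> (norm ?a)"
        using \<open>e > 0\<close> gauge_pos[of "e/4"] gauge_less[of "e/4" "norm ?a"] by auto
      have "?m = ?a - (1/2) *\<^sub>R (y - z)" by (simp add: algebra_simps flip: scaleR_add_left)
      then have "j ?a ?m = norm ?a * \<psi> (norm ?a) - j ?a ((1/2) *\<^sub>R (y - z))"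
        by (simp add: blinfun.diff_right[of "j ?a" ?a] j_self)
      moreover have "j ?a ((1/2) *\<^sub>R (y - z)) \<le> h n * \<psi> (e/4)"
        using pos by (simp add: h_def)
      moreover have "h n * \<psi> (e/4) \<le> h n * \<psi> (norm ?a)"
        using pos by (intro mult_left_mono) (auto simp: h_def)
      ultimately have "(norm ?a - h n) * \<psi> (norm ?a) \<le> j ?a ?m"
        by (simp add: left_diff_distrib)
      also have "\<dots> \<le> norm ?m * \<psi> (norm ?a)" using j_le[of ?a ?m] by (simp add: mult.commute)
      finally have "norm ?a - h n \<le> norm ?m" using pos by simp
      then show ?case by simp
    qed
    show "(\<lambda>n. \<bar>g n\<bar> + h n) \<longlonglongrightarrow> 0"
      using g h by (auto intro!: tendsto_eq_intros)
  qed auto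
  \<comment> \<open>The difference of the two sequences is constantly \<open>z - y\<close>.\<close>
  then show False using \<open>y \<noteq> z\<close> by (simp add: LIMSEQ_const_iff)
qed

text \<open>\<open>resolvent_dist_resolvent\<close> carries almost-fixedness from the varying
  \<open>s n\<close> to the limit \<open>t\<close>: up to a vanishing error the resolvent of
  \<open>z\<close> at \<open>t\<close> is no further from \<open>x n\<close> than \<open>z\<close>
  is, so \<open>Opial\<close> makes \<open>z\<close> a fixed point.\<close>

lemma resolvent_demiclosed:
  fixes C :: "'a set"
  assumes A: "accretive A" and C: "closed C" "convex C" "\<And>s. s > 0 \<Longrightarrow> C \<subseteq> op_range (id_plus s A)"
    and x: "\<And>n. x n \<in> C" "bounded (range x)" "weakly_converges x z"
    and s: "\<And>n. s n > 0" "s \<longlonglongrightarrow> t" "t > 0"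
    and lim: "(\<lambda>n. x n - resolvent (s n) A (x n)) \<longlonglongrightarrow> 0"
  shows "0 \<in> A z"
proof -
  have z: "z \<in> op_range (id_plus t A)" using weakly_closed[OF C(1,2) x(1,3)] C(3) s(3) by blast
  obtain M where M: "\<And>n. norm (x n) \<le> M" using x(2) by (auto simp: bounded_iff)
  have "resolvent t A z = z"
  proof (rule Opial[OF x(3), of "M + norm z"])
    show "norm (x n - z) \<le> M + norm z" for n
      using norm_triangle_ineq4[of "x n" z] M[of n] by linarith
    show "norm (x n - resolvent t A z) \<le> norm (x n - z) + (2 + t / s n) * norm (x n - resolvent (s n) A (x n))" for n
      using A z C(3)[OF s(1)] x(1) s by (intro resolvent_dist_resolvent) auto
    have "(\<lambda>n. (2 + t / s n) * norm (x n - resolvent (s n) A (x n))) \<longlonglongrightarrow> (2 + t / t) * 0"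
      using s lim by (intro tendsto_intros tendsto_norm_zero) auto
    then show "(\<lambda>n. (2 + t / s n) * norm (x n - resolvent (s n) A (x n))) \<longlonglongrightarrow> 0" by simp
  qed
  then show ?thesis using resolvent_in[OF A s(3) z] by simp
qed

text \<open>By sunniness every point strictly between \<open>Q u\<close> and \<open>u\<close>
  retracts to \<open>Q u\<close>, and nonexpansiveness keeps the fixed point \<open>z\<close> at
  least as far from it as from \<open>Q u\<close>. That is the hypothesis of
  \<open>j_nonpos\<close>.\<close>

lemma sunny_retraction_variational:
  assumes "sunny_nonexpansive_retraction Q Z" "z \<in> Z"
  shows "j (z - Q u) (u - Q u) \<le> 0"
proof (rule j_nonpos)
  fix t :: real assume t: "0 < t" "t < 1"
  have Q: "sunny Q" "nonexpansive Q" "Q \<circ> Q = Q" "range Q = Z"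
    using assms by (auto simp: sunny_nonexpansive_retraction_def retraction_onto_def)
  have "Q z = z" using Q(3,4) assms(2) by (metis comp_apply imageE)
  moreover have "Q (t *\<^sub>R u + (1 - t) *\<^sub>R Q u) = Q u" using Q(1) t by (auto simp: sunny_def)
  ultimately have "norm (z - Q u) \<le> norm (z - (t *\<^sub>R u + (1 - t) *\<^sub>R Q u))"
    using Q(2) by (metis nonexpansive_def)
  then show "norm (z - Q u) \<le> norm (z - Q u - t *\<^sub>R (u - Q u))" by (simp add: algebra_simps)
qed

end

section \<open>Real recursions and weighted sums\<close>

text \<open>Since \<open>1 - \<xi> n \<le> exp (- \<xi> n)\<close>, multiplying by the exponential
  of the partial sums gives an eventually nonincreasing sequence, and divergence of the sums forces
  \<open>t\<close> to 0.\<close>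

lemma contraction_tendsto_zero:
  fixes t \<xi> :: "nat \<Rightarrow> real"
  assumes nonneg: "\<And>n. 0 \<le> t n"
    and rec: "\<forall>\<^sub>F n in sequentially. t (Suc n) \<le> (1 - \<xi> n) * t n"
    and diverges: "filterlim (\<lambda>N. \<Sum>n=1..N. \<xi> n) at_top sequentially"
  shows "t \<longlonglongrightarrow> 0"
proof -
  define S where "S N = (\<Sum>n=1..N. \<xi> n)" for N
  \<comment> \<open>\<open>t (Suc n)\<close> is paired with \<open>S n\<close> because the factor
    leading to it has index \<open>n\<close>.\<close>
  define g where "g n = t (Suc n) * exp (S n)" for n
  obtain N where N: "\<And>n. n \<ge> N \<Longrightarrow> t (Suc n) \<le> (1 - \<xi> n) * t n"
    using rec by (auto simp: eventually_sequentially)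
  have g_Suc: "g (Suc n) \<le> g n" if "n \<ge> N" for n
  proof -
    have "t (Suc (Suc n)) \<le> (1 - \<xi> (Suc n)) * t (Suc n)" using N that by simp
    also have "\<dots> \<le> exp (- \<xi> (Suc n)) * t (Suc n)"
      using exp_ge_add_one_self[of "- \<xi> (Suc n)"] by (intro mult_right_mono nonneg) auto
    finally have "g (Suc n) \<le> exp (- \<xi> (Suc n)) * t (Suc n) * exp (S n + \<xi> (Suc n))"
      by (simp add: g_def S_def)
    also have "\<dots> = g n" by (simp add: g_def exp_add exp_minus field_simps)
    finally show ?thesis .
  qed
  have "g n \<le> g N" if "N \<le> n" for n
    using that by (induction n rule: dec_induct) (auto intro: order_trans g_Suc)
  then have le: "\<forall>\<^sub>F n in sequentially. t (Suc n) \<le> g N * exp (- S n)"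
    unfolding eventually_sequentially g_def
    by (intro exI[of _ N]) (simp add: exp_minus pos_le_divide_eq divide_inverse[symmetric])
  have "((\<lambda>n. exp (- S n)) \<longlongrightarrow> 0) sequentially"
    using diverges unfolding S_def[abs_def]
    by (intro filterlim_compose[OF exp_at_bot] filterlim_compose[OF filterlim_uminus_at_bot_at_top])
  then have "(\<lambda>n. g N * exp (- S n)) \<longlonglongrightarrow> 0" by (rule tendsto_mult_right_zero)
  with le have "(\<lambda>n. t (Suc n)) \<longlonglongrightarrow> 0"
    using nonneg by (intro tendsto_sandwich[OF _ le tendsto_const]) auto
  then show ?thesis by (rule LIMSEQ_imp_Suc)
qed

text \<open>Because \<open>a\<close> is bounded and \<open>\<xi> \<longlonglongrightarrow> 0\<close>, a step that decreases \<open>a\<close> by a fixed \<open>\<delta>\<close>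
  contracts the excess \<open>max (a n - \<epsilon>) 0\<close> at least by the factor \<open>1 - \<xi> n\<close>, so it does no harm
  to the recursion.\<close>

lemma descent_or_contraction_tendsto_zero:
  fixes a \<xi> :: "nat \<Rightarrow> real"
  assumes nonneg: "\<And>n. 0 \<le> a n" and bnd: "\<forall>\<^sub>F n in sequentially. a n \<le> M"
    and \<xi>: "\<forall>\<^sub>F n in sequentially. 0 \<le> \<xi> n" "\<xi> \<longlonglongrightarrow> 0"
    and diverges: "filterlim (\<lambda>N. \<Sum>n=1..N. \<xi> n) at_top sequentially"
    and rec: "\<And>\<epsilon>. \<epsilon> > 0 \<Longrightarrow> \<exists>\<delta>>0. \<forall>\<^sub>F n in sequentially.
      a (Suc n) \<le> a n - \<delta> \<or> a (Suc n) \<le> \<epsilon> \<or> a (Suc n) \<le> (1 - \<xi> n) * a n + \<xi> n * \<epsilon>"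
  shows "a \<longlonglongrightarrow> 0"
proof (rule tendstoI)
  fix e :: real assume "e > 0"
  define \<epsilon> where "\<epsilon> = e / 2"
  have "\<epsilon> > 0" using \<open>e > 0\<close> by (simp add: \<epsilon>_def)
  obtain \<delta> where "\<delta> > 0" and \<delta>: "\<forall>\<^sub>F n in sequentially.
      a (Suc n) \<le> a n - \<delta> \<or> a (Suc n) \<le> \<epsilon> \<or> a (Suc n) \<le> (1 - \<xi> n) * a n + \<xi> n * \<epsilon>"
    using rec[OF \<open>\<epsilon> > 0\<close>] by blast
  define t where "t n = max (a n - \<epsilon>) 0" for n
  have "\<forall>\<^sub>F n in sequentially. \<xi> n * M < \<delta>"
    using order_tendstoD(2)[OF tendsto_mult_left_zero[OF \<xi>(2), of M] \<open>\<delta> > 0\<close>] .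
  moreover have "\<forall>\<^sub>F n in sequentially. \<xi> n < 1"
    using order_tendstoD(2)[OF \<xi>(2)] by simp
  ultimately have "\<forall>\<^sub>F n in sequentially. t (Suc n) \<le> (1 - \<xi> n) * t n"
    using bnd \<xi>(1) \<delta>
  proof eventually_elim
    case (elim n)
    have t: "0 \<le> t n" "a n - \<epsilon> \<le> t n" "t n \<le> M"
      using \<open>\<epsilon> > 0\<close> elim nonneg[of n] by (auto simp: t_def)
    have nn: "0 \<le> (1 - \<xi> n) * t n" using elim t by (intro mult_nonneg_nonneg) auto
    have m: "\<xi> n * t n \<le> \<xi> n * M" using elim t by (intro mult_left_mono) auto
    show ?case
    proof (cases "a (Suc n) \<le> \<epsilon>")
      case True
      then show ?thesis using nn by (simp add: t_def)
    next
      case False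
      then have t': "t (Suc n) = a (Suc n) - \<epsilon>" by (simp add: t_def)
      from False elim consider "a (Suc n) \<le> a n - \<delta>" | "a (Suc n) \<le> (1 - \<xi> n) * a n + \<xi> n * \<epsilon>"
        by blast
      then show ?thesis
      proof cases
        case 1
        then show ?thesis using t' t m elim by (simp add: algebra_simps)
      next
        case 2
        then have "a (Suc n) - \<epsilon> \<le> (1 - \<xi> n) * (a n - \<epsilon>)" by (simp add: algebra_simps)
        also have "\<dots> \<le> (1 - \<xi> n) * t n" using elim t by (intro mult_left_mono) auto
        finally show ?thesis by (simp add: t')
      qed
    qed
  qed
  then have "t \<longlonglongrightarrow> 0"
    by (intro contraction_tendsto_zero[OF _ _ diverges]) (auto simp: t_def)
  from order_tendstoD(2)[OF this \<open>\<epsilon> > 0\<close>] show "\<forall>\<^sub>F n in sequentially. dist (a n) 0 < e"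
    by eventually_elim (use nonneg in \<open>simp add: t_def \<epsilon>_def max_def split: if_splits\<close>)
qed

section \<open>Weighted series of vectors and choice of subsequences\<close>

lemma weighted_sum_norm_le:
  fixes x :: "nat \<Rightarrow> 'a::banach"
  assumes c: "\<And>k. 0 \<le> c k" "summable c" and x: "\<And>k. norm (x k) \<le> d"
  shows "summable (\<lambda>k. c k *\<^sub>R x k)" "norm (\<Sum>k. c k *\<^sub>R x k) \<le> (\<Sum>k. c k) * d"
proof -
  have le: "norm (c k *\<^sub>R x k) \<le> c k * d" for k using c x by (simp add: mult_left_mono)
  have s: "summable (\<lambda>k. c k * d)" using c(2) by (rule summable_mult2)
  show "summable (\<lambda>k. c k *\<^sub>R x k)" using le by (intro summable_comparison_test'[OF s])
  show "norm (\<Sum>k. c k *\<^sub>R x k) \<le> (\<Sum>k. c k) * d"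
    using norm_suminf_le[OF le s] suminf_mult2[OF c(2), of d] by simp
qed

text \<open>Setting the weight at \<open>i\<close> to 0 reduces this to the previous bound. It
  serves to isolate one resolvent in \<open>w n\<close>.\<close>

lemma weighted_sum_remove_norm_le:
  fixes x :: "nat \<Rightarrow> 'a::banach"
  assumes c: "\<And>k. 0 \<le> c k" "summable c" and x: "\<And>k. norm (x k) \<le> d"
  shows "norm ((\<Sum>k. c k *\<^sub>R x k) - c i *\<^sub>R x i) \<le> ((\<Sum>k. c k) - c i) * d"
proof -
  let ?c = "\<lambda>k. c k - (if k = i then c k else 0)"
  have "?c sums ((\<Sum>k. c k) - c i)" using c(2) by (intro sums_diff summable_sums sums_single)
  then have sc: "summable ?c" "suminf ?c = (\<Sum>k. c k) - c i" by (auto simp: sums_iff)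
  have "(\<lambda>k. c k *\<^sub>R x k - (if k = i then c k *\<^sub>R x k else 0)) sums ((\<Sum>k. c k *\<^sub>R x k) - c i *\<^sub>R x i)"
    by (intro sums_diff summable_sums sums_single weighted_sum_norm_le[OF c x])
  also have "(\<lambda>k. c k *\<^sub>R x k - (if k = i then c k *\<^sub>R x k else 0)) = (\<lambda>k. ?c k *\<^sub>R x k)"
    by auto
  finally have "(\<Sum>k. ?c k *\<^sub>R x k) = (\<Sum>k. c k *\<^sub>R x k) - c i *\<^sub>R x i" by (rule sums_unique[symmetric])
  moreover have "norm (\<Sum>k. ?c k *\<^sub>R x k) \<le> suminf ?c * d"
    using c(1) by (intro weighted_sum_norm_le(2)[OF _ sc(1) x]) auto
  ultimately show ?thesis by (simp add: sc(2))
qed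

text \<open>The predicate may vary with \<open>k\<close>, so a tolerance can shrink along the
  subsequence.\<close>

lemma frequently_subsequence:
  assumes "\<And>k. \<exists>\<^sub>F n in sequentially. P k n"
  obtains s :: "nat \<Rightarrow> nat" where "strict_mono s" "\<And>k. P k (s k)"
proof -
  have "\<exists>s. \<forall>k. P k (s k) \<and> s k < s (Suc k)"
  proof (rule dependent_nat_choice)
    show "\<exists>n. P 0 n" using assms[of 0] by (blast dest: frequently_ex)
    fix n k
    have "\<exists>\<^sub>F m in sequentially. P (Suc k) m \<and> n < m"
      by (intro frequently_eventually_frequently assms eventually_gt_at_top)
    then show "\<exists>m. P (Suc k) m \<and> n < m" by (rule frequently_ex)
  qed
  then show thesis using that by (auto simp: strict_mono_Suc_iff)
qed

section \<open>The iteration\<close>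

locale resolvent_iteration =
  fixes C :: "'a::banach set"
    and A :: "nat \<Rightarrow> 'a \<Rightarrow> 'a set"
    and rs \<xi> \<zeta> :: "nat \<Rightarrow> real"
    and \<phi> :: "nat \<Rightarrow> nat \<Rightarrow> real"
    and u :: 'a and v w :: "nat \<Rightarrow> 'a"
  assumes uc: "uniformly_convex TYPE('a)"
    and accretive: "\<And>i. accretive (A i)"
    and C_range: "\<And>i s. s > 0 \<Longrightarrow> C \<subseteq> op_range (id_plus s (A i))"
    and rs_pos: "\<And>n. n \<ge> 1 \<Longrightarrow> rs n > 0"
    and v_in: "\<And>n. n \<ge> 1 \<Longrightarrow> v n \<in> C" and w_in: "\<And>n. n \<ge> 1 \<Longrightarrow> w n \<in> C"
    and v_Suc: "\<And>n. n \<ge> 1 \<Longrightarrow>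
           v (Suc n) = \<xi> n *\<^sub>R u + (1 - \<zeta> n) *\<^sub>R resolvent (rs n) (A 0) (v n)
                       + (\<zeta> n - \<xi> n) *\<^sub>R resolvent (rs n) (A 0) (w n)"
    and w_eq: "\<And>n. n \<ge> 1 \<Longrightarrow>
           w n = \<phi> n 0 *\<^sub>R v n
                 + (\<Sum>i. \<phi> n (Suc i) *\<^sub>R resolvent (rs n) (A (Suc i)) (v n))"
    and \<zeta>: "\<And>n. n \<ge> 1 \<Longrightarrow> \<zeta> n \<in> {0..1}"
    and \<xi>: "\<And>n. n \<ge> 1 \<Longrightarrow> \<xi> n \<in> {0..1}"
    and \<phi>: "\<And>n i. n \<ge> 1 \<Longrightarrow> \<phi> n i \<in> {0..1}"
    and \<xi>_lim: "\<xi> \<longlonglongrightarrow> 0"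
    and \<phi>_summable: "\<And>n. n \<ge> 1 \<Longrightarrow> summable (\<lambda>i. \<phi> n (Suc i))"
    and \<phi>_sum: "\<And>n. n \<ge> 1 \<Longrightarrow> \<phi> n 0 + (\<Sum>i. \<phi> n (Suc i)) = 1"
    and liminf_pos: "\<And>i. i \<ge> 1 \<Longrightarrow> liminf (\<lambda>n. ereal (\<zeta> n * \<phi> n 0 * \<phi> n i)) > 0"
begin

abbreviation J :: "nat \<Rightarrow> nat \<Rightarrow> 'a \<Rightarrow> 'a" where
  "J n i \<equiv> resolvent (rs n) (A i)"

lemma in_range: "n \<ge> 1 \<Longrightarrow> x \<in> C \<Longrightarrow> x \<in> op_range (id_plus (rs n) (A i))"
  using C_range[OF rs_pos, of n i] by blast

text \<open>A product of factors from the unit interval is at most each factor, so the positive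
  lower limit bounds all three weights away from 0 at once; \<open>\<xi> n < c / 2\<close> then
  handles \<open>\<zeta> n - \<xi> n\<close>.\<close>

lemma weights_bounded_below:
  assumes "i \<ge> 1"
  obtains c where "c > 0"
    "\<forall>\<^sub>F n in sequentially. n \<ge> 1 \<and> c \<le> \<zeta> n \<and> c \<le> \<phi> n 0 \<and> c \<le> \<phi> n i \<and> c / 2 \<le> \<zeta> n - \<xi> n"
proof -
  obtain c where c: "0 < ereal c" "ereal c < liminf (\<lambda>n. ereal (\<zeta> n * \<phi> n 0 * \<phi> n i))"
    using ereal_dense2[OF liminf_pos[OF assms]] by blast
  then have "c > 0" by simp
  have "\<forall>\<^sub>F n in sequentially. c < \<zeta> n * \<phi> n 0 * \<phi> n i"
    using less_LiminfD[OF c(2)] by simp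
  moreover have "\<forall>\<^sub>F n in sequentially. \<xi> n < c / 2"
    using order_tendstoD(2)[OF \<xi>_lim, of "c / 2"] \<open>c > 0\<close> by simp
  ultimately have "\<forall>\<^sub>F n in sequentially.
      n \<ge> 1 \<and> c \<le> \<zeta> n \<and> c \<le> \<phi> n 0 \<and> c \<le> \<phi> n i \<and> c / 2 \<le> \<zeta> n - \<xi> n"
    using eventually_ge_at_top[of 1]
  proof eventually_elim
    case (elim n)
    have rng: "0 \<le> \<zeta> n" "\<zeta> n \<le> 1" "0 \<le> \<phi> n 0" "\<phi> n 0 \<le> 1" "0 \<le> \<phi> n i" "\<phi> n i \<le> 1"
      using \<zeta>[of n] \<phi>[of n 0] \<phi>[of n i] elim by auto
    have "\<zeta> n * \<phi> n 0 \<le> \<zeta> n" "\<zeta> n * \<phi> n 0 \<le> \<phi> n 0" "0 \<le> \<zeta> n * \<phi> n 0"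
      using rng by (auto simp: mult_left_le mult_left_le_one_le)
    moreover from this have "\<zeta> n * \<phi> n 0 * \<phi> n i \<le> \<zeta> n * \<phi> n 0" "\<zeta> n * \<phi> n 0 * \<phi> n i \<le> \<phi> n i"
      using rng by (auto intro: mult_left_le mult_left_le_one_le)
    ultimately show ?case using elim by linarith
  qed
  with \<open>c > 0\<close> show thesis by (rule that)
qed

lemma \<xi>_le_\<zeta>: "\<forall>\<^sub>F n in sequentially. n \<ge> 1 \<and> \<xi> n \<le> \<zeta> n"
proof -
  obtain c where "c > 0"
    "\<forall>\<^sub>F n in sequentially. n \<ge> 1 \<and> c \<le> \<zeta> n \<and> c \<le> \<phi> n 0 \<and> c \<le> \<phi> n 1 \<and> c / 2 \<le> \<zeta> n - \<xi> n"
    using weights_bounded_below[of 1] by auto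
  from this(2) show ?thesis by eventually_elim (use \<open>c > 0\<close> in auto)
qed

section \<open>Estimates relative to a common zero\<close>

context
  fixes p :: 'a
  assumes zero: "\<And>i. 0 \<in> A i p"
begin

lemma J_dist_le: "n \<ge> 1 \<Longrightarrow> x \<in> C \<Longrightarrow> norm (J n i x - p) \<le> norm (x - p)"
  by (intro resolvent_dist_zero accretive rs_pos in_range zero)

lemma v_Suc_diff:
  assumes "n \<ge> 1"
  shows "v (Suc n) - p = \<xi> n *\<^sub>R (u - p) + (1 - \<zeta> n) *\<^sub>R (J n 0 (v n) - p)
    + (\<zeta> n - \<xi> n) *\<^sub>R (J n 0 (w n) - p)"
  unfolding v_Suc[OF assms] by (simp add: algebra_simps)

text \<open>The term with \<open>w n\<close> stays unestimated so that the inequality can be solved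
  for it in \<open>asymptotic_regularity\<close>.\<close>

lemma v_Suc_norm_le:
  assumes "n \<ge> 1" "\<xi> n \<le> \<zeta> n"
  shows "norm (v (Suc n) - p) \<le> \<xi> n * norm (u - p) + (1 - \<zeta> n) * norm (v n - p)
    + (\<zeta> n - \<xi> n) * norm (J n 0 (w n) - p)"
proof -
  have "norm (v (Suc n) - p) \<le> norm (\<xi> n *\<^sub>R (u - p)) + norm ((1 - \<zeta> n) *\<^sub>R (J n 0 (v n) - p))
    + norm ((\<zeta> n - \<xi> n) *\<^sub>R (J n 0 (w n) - p))"
    unfolding v_Suc_diff[OF assms(1)] by (intro norm_triangle_le add_right_mono norm_triangle_ineq)
  also have "\<dots> = \<xi> n * norm (u - p) + (1 - \<zeta> n) * norm (J n 0 (v n) - p)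
    + (\<zeta> n - \<xi> n) * norm (J n 0 (w n) - p)"
    using assms \<xi>[of n] \<zeta>[of n] by simp
  also have "\<dots> \<le> \<xi> n * norm (u - p) + (1 - \<zeta> n) * norm (v n - p)
    + (\<zeta> n - \<xi> n) * norm (J n 0 (w n) - p)"
    using assms \<zeta>[of n] J_dist_le[OF assms(1) v_in[OF assms(1)], of 0]
    by (auto intro: mult_left_mono)
  finally show ?thesis .
qed

lemma w_diff:
  assumes "n \<ge> 1"
  shows "w n - p = \<phi> n 0 *\<^sub>R (v n - p) + (\<Sum>i. \<phi> n (Suc i) *\<^sub>R (J n (Suc i) (v n) - p))"
proof -
  note \<phi>_nonneg = \<phi>[OF assms, of "Suc _", unfolded atLeastAtMost_iff, THEN conjunct1]
  have s1: "summable (\<lambda>i. \<phi> n (Suc i) *\<^sub>R (J n (Suc i) (v n) - p))"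
    by (rule weighted_sum_norm_le(1)[OF \<phi>_nonneg \<phi>_summable[OF assms] J_dist_le[OF assms v_in[OF assms]]])
  have s2: "summable (\<lambda>i. \<phi> n (Suc i) *\<^sub>R p)"
    by (intro summable_scaleR_left \<phi>_summable assms)
  have "(\<Sum>i. \<phi> n (Suc i) *\<^sub>R J n (Suc i) (v n))
      = (\<Sum>i. \<phi> n (Suc i) *\<^sub>R (J n (Suc i) (v n) - p) + \<phi> n (Suc i) *\<^sub>R p)"
    by (simp add: scaleR_diff_right)
  also have "\<dots> = (\<Sum>i. \<phi> n (Suc i) *\<^sub>R (J n (Suc i) (v n) - p)) + (\<Sum>i. \<phi> n (Suc i)) *\<^sub>R p"
    using suminf_add[OF s1 s2] suminf_scaleR_left[OF \<phi>_summable[OF assms], of p] by simp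
  also have "(\<Sum>i. \<phi> n (Suc i)) = 1 - \<phi> n 0" using \<phi>_sum[OF assms] by simp
  finally show ?thesis unfolding w_eq[OF assms] by (simp add: algebra_simps)
qed

text \<open>The two splittings serve two uses of uniform convexity: \<open>v n\<close> against all
  resolvents together, and \<open>v n\<close> against a single one.\<close>

lemma w_tail_norm_le:
  assumes "n \<ge> 1"
  shows "norm (\<Sum>i. \<phi> n (Suc i) *\<^sub>R (J n (Suc i) (v n) - p)) \<le> (1 - \<phi> n 0) * norm (v n - p)"
    and "norm (w n - p - (\<phi> n 0 *\<^sub>R (v n - p) + \<phi> n (Suc i) *\<^sub>R (J n (Suc i) (v n) - p)))
      \<le> (1 - \<phi> n 0 - \<phi> n (Suc i)) * norm (v n - p)"
proof -
  note \<phi>_nonneg = \<phi>[OF assms, of "Suc _", unfolded atLeastAtMost_iff, THEN conjunct1]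
  have sum: "(\<Sum>i. \<phi> n (Suc i)) = 1 - \<phi> n 0" using \<phi>_sum[OF assms] by simp
  show "norm (\<Sum>i. \<phi> n (Suc i) *\<^sub>R (J n (Suc i) (v n) - p)) \<le> (1 - \<phi> n 0) * norm (v n - p)"
    using weighted_sum_norm_le(2)[OF \<phi>_nonneg \<phi>_summable[OF assms] J_dist_le[OF assms v_in[OF assms]]]
    by (simp add: sum)
  have J_le: "norm (J n (Suc k) (v n) - p) \<le> norm (v n - p)" for k
    by (rule J_dist_le[OF assms v_in[OF assms]])
  have "norm ((\<Sum>k. \<phi> n (Suc k) *\<^sub>R (J n (Suc k) (v n) - p)) - \<phi> n (Suc i) *\<^sub>R (J n (Suc i) (v n) - p))
      \<le> ((\<Sum>k. \<phi> n (Suc k)) - \<phi> n (Suc i)) * norm (v n - p)"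
    by (rule weighted_sum_remove_norm_le) (rule \<phi>_nonneg \<phi>_summable[OF assms] J_le)+
  then show "norm (w n - p - (\<phi> n 0 *\<^sub>R (v n - p) + \<phi> n (Suc i) *\<^sub>R (J n (Suc i) (v n) - p)))
      \<le> (1 - \<phi> n 0 - \<phi> n (Suc i)) * norm (v n - p)"
    by (simp add: sum w_diff[OF assms])
qed

lemma w_norm_le:
  assumes "n \<ge> 1"
  shows "norm (w n - p) \<le> norm (v n - p)"
proof -
  have "norm (w n - p) \<le> \<phi> n 0 * norm (v n - p) + (1 - \<phi> n 0) * norm (v n - p)"
    unfolding w_diff[OF assms] using \<phi>[OF assms, of 0] w_tail_norm_le(1)[OF assms]
    by (intro order_trans[OF norm_triangle_ineq] add_mono) auto
  then show ?thesis by (simp add: algebra_simps)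
qed

lemma v_Suc_norm_le':
  assumes "n \<ge> 1" "\<xi> n \<le> \<zeta> n"
  shows "norm (v (Suc n) - p) \<le> \<xi> n * norm (u - p) + (1 - \<xi> n) * norm (v n - p)"
proof -
  have "(\<zeta> n - \<xi> n) * norm (J n 0 (w n) - p) \<le> (\<zeta> n - \<xi> n) * norm (v n - p)"
    using assms J_dist_le[OF assms(1) w_in[OF assms(1)], of 0] w_norm_le[OF assms(1)]
    by (intro mult_left_mono) auto
  then show ?thesis using v_Suc_norm_le[OF assms] by (simp add: algebra_simps)
qed

lemma v_bounded:
  obtains M where "\<forall>\<^sub>F n in sequentially. norm (v n - p) \<le> M"
proof -
  \<comment> \<open>The induction starts at \<open>N\<close>, from where on
    \<open>\<zeta> n - \<xi> n\<close> is known to be nonnegative.\<close>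
  obtain N where N: "\<And>n. n \<ge> N \<Longrightarrow> n \<ge> 1 \<and> \<xi> n \<le> \<zeta> n"
    using \<xi>_le_\<zeta> unfolding eventually_sequentially by blast
  define M where "M = max (norm (u - p)) (norm (v N - p))"
  have "norm (v n - p) \<le> M" if "N \<le> n" for n
    using that
  proof (induction n rule: dec_induct)
    case base
    show ?case by (simp add: M_def)
  next
    case (step n)
    have n: "n \<ge> 1" "\<xi> n \<le> \<zeta> n" using N[of n] step by auto
    have "norm (v (Suc n) - p) \<le> \<xi> n * norm (u - p) + (1 - \<xi> n) * norm (v n - p)"
      by (rule v_Suc_norm_le'[OF n])
    also have "\<dots> \<le> \<xi> n * M + (1 - \<xi> n) * M"
      using \<xi>[OF n(1)] step.IH by (intro add_mono mult_left_mono) (auto simp: M_def)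
    finally show ?case by (simp add: algebra_simps)
  qed
  then show thesis using that by (auto simp: eventually_sequentially)
qed

text \<open>Along any filter on which the distance to \<open>p\<close> does not drop substantially in one step, none
  of the convex combinations and resolvents in that step can bring its arguments much closer to
  \<open>p\<close>; uniform convexity then forces all of these points together.\<close>

lemma asymptotic_regularity:
  assumes F: "F \<le> sequentially"
    and drop: "((\<lambda>n. max 0 (norm (v n - p) - norm (v (Suc n) - p))) \<longlongrightarrow> 0) F"
  shows "((\<lambda>n. v n - J n i (v n)) \<longlongrightarrow> 0) F" "((\<lambda>n. v (Suc n) - v n) \<longlongrightarrow> 0) F"
proof -
  define a where "a n = norm (v n - p)" for n
  define e where "e n = max 0 (a n - a (Suc n))" for n
  have e: "(e \<longlongrightarrow> 0) F" using drop by (simp add: e_def[abs_def] a_def)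
  have \<xi>F: "(\<xi> \<longlongrightarrow> 0) F" using \<xi>_lim F by (rule tendsto_mono[rotated])
  obtain M where "\<forall>\<^sub>F n in sequentially. norm (v n - p) \<le> M" by (rule v_bounded)
  then have M: "\<forall>\<^sub>F n in F. a n \<le> M" unfolding a_def by (rule filter_leD[OF F])
  obtain c where "c > 0" and
    "\<forall>\<^sub>F n in sequentially. n \<ge> 1 \<and> c \<le> \<zeta> n \<and> c \<le> \<phi> n 0 \<and> c \<le> \<phi> n 1 \<and> c / 2 \<le> \<zeta> n - \<xi> n"
    using weights_bounded_below[of 1] by auto
  from filter_leD[OF F this(2)]
  have c: "\<forall>\<^sub>F n in F. n \<ge> 1 \<and> c \<le> \<zeta> n \<and> c \<le> \<phi> n 0 \<and> c \<le> \<phi> n 1 \<and> c / 2 \<le> \<zeta> n - \<xi> n" .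
  \<comment> \<open>Solving the one-step estimate for \<open>a n - norm (J n 0 (w n) - p)\<close>
    divides by \<open>\<zeta> n - \<xi> n\<close>, which is at least \<open>c / 2\<close>.\<close>
  define g where "g n = (\<xi> n * norm (u - p) + e n) * (2 / c)" for n
  have "((\<lambda>n. (\<xi> n * norm (u - p) + e n) * (2 / c)) \<longlongrightarrow> (0 * norm (u - p) + 0) * (2 / c)) F"
    by (intro tendsto_intros \<xi>F e)
  then have g: "(g \<longlongrightarrow> 0) F" by (simp add: g_def[abs_def])
  have lower: "\<forall>\<^sub>F n in F. a n - g n \<le> norm (J n 0 (w n) - p)"
    using c
  proof eventually_elim
    case (elim n)
    then have n: "n \<ge> 1" "\<xi> n \<le> \<zeta> n" using \<open>c > 0\<close> by auto
    let ?D = "norm (J n 0 (w n) - p)"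
    have D: "?D \<le> a n"
      using J_dist_le[OF n(1) w_in[OF n(1)], of 0] w_norm_le[OF n(1)] by (simp add: a_def)
    have "a n - e n \<le> a (Suc n)" by (simp add: e_def)
    also have "\<dots> \<le> \<xi> n * norm (u - p) + (1 - \<zeta> n) * a n + (\<zeta> n - \<xi> n) * ?D"
      unfolding a_def by (rule v_Suc_norm_le[OF n])
    finally have "(\<zeta> n - \<xi> n) * (a n - ?D) \<le> \<xi> n * norm (u - p) + e n - \<xi> n * a n"
      by (simp add: algebra_simps)
    also have "\<dots> \<le> \<xi> n * norm (u - p) + e n" using \<xi>[OF n(1)] by (simp add: a_def)
    finally have "(\<zeta> n - \<xi> n) * (a n - ?D) \<le> \<xi> n * norm (u - p) + e n" .
    moreover have "(c / 2) * (a n - ?D) \<le> (\<zeta> n - \<xi> n) * (a n - ?D)"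
      using elim D by (intro mult_right_mono) auto
    ultimately have "(c / 2) * (a n - ?D) \<le> \<xi> n * norm (u - p) + e n" by linarith
    then have "a n - ?D \<le> g n" using \<open>c > 0\<close> by (simp add: g_def field_simps)
    then show ?case by simp
  qed
  \<comment> \<open>\<open>resolvent_dist_zero_midpoint\<close> turns the lower bound for
    \<open>J n 0 (w n)\<close> into one for the midpoint with \<open>w n\<close>.\<close>
  have wJw: "((\<lambda>n. w n - J n 0 (w n)) \<longlongrightarrow> 0) F"
  proof -
    have "((\<lambda>n. (w n - p) - (J n 0 (w n) - p)) \<longlongrightarrow> 0) F"
    proof (rule uniformly_convex_tendsto[OF uc, of "1/2" a M _ _ _ "\<lambda>_. 1/2" "\<lambda>_. 1/2" g])
      show "\<forall>\<^sub>F n in F. norm (w n - p) \<le> a n"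
        using c by eventually_elim (use w_norm_le in \<open>auto simp: a_def\<close>)
      show "\<forall>\<^sub>F n in F. norm (J n 0 (w n) - p) \<le> a n"
        using c by eventually_elim (use w_norm_le J_dist_le w_in in \<open>force simp: a_def intro: order_trans\<close>)
      show "\<forall>\<^sub>F n in F. (1/2 + 1/2) * a n - g n \<le> norm ((1/2) *\<^sub>R (w n - p) + (1/2) *\<^sub>R (J n 0 (w n) - p))"
        using c lower
      proof eventually_elim
        case (elim n)
        then have "n \<ge> 1" by simp
        have "norm (J n 0 (w n) - p) \<le> norm ((1/2) *\<^sub>R (w n - p) + (1/2) *\<^sub>R (J n 0 (w n) - p))"
          using \<open>n \<ge> 1\<close> by (intro resolvent_dist_zero_midpoint accretive rs_pos in_range w_in zero)
        then show ?case using elim by simp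
      qed
    qed (use M g in auto)
    then show ?thesis by simp
  qed
  have lower_w: "\<forall>\<^sub>F n in F. a n - g n \<le> norm (w n - p)"
    using c lower by eventually_elim (use J_dist_le w_in in \<open>force intro: order_trans\<close>)
  have wv: "((\<lambda>n. w n - v n) \<longlongrightarrow> 0) F"
  proof -
    \<comment> \<open>\<open>w n - p\<close> is a convex combination of \<open>v n - p\<close> and
      the normalised tail \<open>y n\<close>. The second weight \<open>1 - \<phi> n 0\<close> is at
      least \<open>\<phi> n 1\<close>, hence at least \<open>c\<close>.\<close>
    define Y where "Y n = (\<Sum>i. \<phi> n (Suc i) *\<^sub>R (J n (Suc i) (v n) - p))" for n
    define y where "y n = (1 / (1 - \<phi> n 0)) *\<^sub>R Y n" for n
    have *: "\<forall>\<^sub>F n in F. n \<ge> 1 \<and> c \<le> \<phi> n 0 \<and> c \<le> 1 - \<phi> n 0 \<and> (1 - \<phi> n 0) *\<^sub>R y n = Y n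
      \<and> norm (y n) \<le> a n"
      using c
    proof eventually_elim
      case (elim n)
      then have "n \<ge> 1" by simp
      have "\<phi> n (Suc 0) \<le> (\<Sum>i. \<phi> n (Suc i))"
        using sum_le_suminf[OF \<phi>_summable[OF \<open>n \<ge> 1\<close>], of "{0}"] \<phi>[OF \<open>n \<ge> 1\<close>] by simp
      then have le: "c \<le> 1 - \<phi> n 0" using \<phi>_sum[OF \<open>n \<ge> 1\<close>] elim by simp
      then have pos: "0 < 1 - \<phi> n 0" using \<open>c > 0\<close> by linarith
      have "norm (Y n) \<le> a n * (1 - \<phi> n 0)"
        using w_tail_norm_le(1)[OF \<open>n \<ge> 1\<close>] by (simp add: Y_def a_def mult.commute)
      then have "norm (Y n) / (1 - \<phi> n 0) \<le> a n" by (simp only: pos_divide_le_eq[OF pos])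
      moreover have "norm (y n) = norm (Y n) / (1 - \<phi> n 0)"
        using pos by (simp add: y_def)
      moreover have "(1 - \<phi> n 0) *\<^sub>R y n = Y n" using pos by (simp add: y_def)
      ultimately show ?case using le elim by simp
    qed
    have "((\<lambda>n. (v n - p) - y n) \<longlongrightarrow> 0) F"
    proof (rule uniformly_convex_tendsto[OF uc \<open>c > 0\<close>, of a M _ _ _ "\<lambda>n. \<phi> n 0" "\<lambda>n. 1 - \<phi> n 0" g])
      show "\<forall>\<^sub>F n in F. (\<phi> n 0 + (1 - \<phi> n 0)) * a n - g n \<le> norm (\<phi> n 0 *\<^sub>R (v n - p) + (1 - \<phi> n 0) *\<^sub>R y n)"
        using * lower_w by eventually_elim (simp add: Y_def w_diff)
      show "\<forall>\<^sub>F n in F. norm (y n) \<le> a n" "\<forall>\<^sub>F n in F. c \<le> \<phi> n 0" "\<forall>\<^sub>F n in F. c \<le> 1 - \<phi> n 0"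
        using * by (auto elim: eventually_mono)
    qed (use M g in \<open>auto simp: a_def\<close>)
    then show ?thesis
    proof (rule Lim_transform_bound[rotated])
      show "\<forall>\<^sub>F n in F. norm (w n - v n) \<le> norm ((v n - p) - y n)"
        using *
      proof eventually_elim
        case (elim n)
        have "w n - v n = (w n - p) - (v n - p)" by simp
        also have "\<dots> = \<phi> n 0 *\<^sub>R (v n - p) + (1 - \<phi> n 0) *\<^sub>R y n - (v n - p)"
          using elim by (simp add: w_diff Y_def)
        also have "\<dots> = - ((1 - \<phi> n 0) *\<^sub>R ((v n - p) - y n))"
          by (simp add: algebra_simps)
        finally have "norm (w n - v n) = (1 - \<phi> n 0) * norm ((v n - p) - y n)"
          using elim \<open>c > 0\<close> by simp
        also have "\<dots> \<le> 1 * norm ((v n - p) - y n)"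
          using elim \<open>c > 0\<close> by (intro mult_right_mono) auto
        finally show ?case by simp
      qed
    qed
  qed
  \<comment> \<open>\<open>v n\<close> and \<open>w n\<close> are asymptotically equal, so by
    nonexpansiveness \<open>v n\<close> inherits from \<open>w n\<close> that the resolvent of
    \<open>A 0\<close> almost fixes it.\<close>
  have vJ0v: "((\<lambda>n. v n - J n 0 (v n)) \<longlongrightarrow> 0) F"
  proof (rule tendsto_0_le[where K = 1])
    have "((\<lambda>n. 2 * norm (w n - v n) + norm (w n - J n 0 (w n))) \<longlongrightarrow> 2 * norm (0::'a) + norm (0::'a)) F"
      by (intro tendsto_intros wv wJw)
    then show "((\<lambda>n. 2 * norm (w n - v n) + norm (w n - J n 0 (w n))) \<longlongrightarrow> 0) F" by simp
    show "\<forall>\<^sub>F n in F. norm (v n - J n 0 (v n)) \<le> norm (2 * norm (w n - v n) + norm (w n - J n 0 (w n))) * 1"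
      using c
    proof eventually_elim
      case (elim n)
      then have "norm (J n 0 (w n) - J n 0 (v n)) \<le> norm (w n - v n)"
        by (intro resolvent_nonexpansive accretive rs_pos in_range w_in v_in) auto
      moreover have "v n - J n 0 (v n)
          = (w n - J n 0 (w n)) + (J n 0 (w n) - J n 0 (v n)) - (w n - v n)"
        by simp
      ultimately show ?case
        using norm_triangle_ineq4[of "(w n - J n 0 (w n)) + (J n 0 (w n) - J n 0 (v n))" "w n - v n"]
          norm_triangle_ineq[of "w n - J n 0 (w n)" "J n 0 (w n) - J n 0 (v n)"] by simp
    qed
  qed
  show "((\<lambda>n. v n - J n i (v n)) \<longlongrightarrow> 0) F"
  proof (cases i)
    case 0
    then show ?thesis using vJ0v by simp
  next
    case (Suc k)
    obtain d where "d > 0" and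
      "\<forall>\<^sub>F n in sequentially. n \<ge> 1 \<and> d \<le> \<zeta> n \<and> d \<le> \<phi> n 0 \<and> d \<le> \<phi> n i \<and> d / 2 \<le> \<zeta> n - \<xi> n"
      using weights_bounded_below[of i] Suc by auto
    from filter_leD[OF F this(2)]
    have d: "\<forall>\<^sub>F n in F. n \<ge> 1 \<and> d \<le> \<zeta> n \<and> d \<le> \<phi> n 0 \<and> d \<le> \<phi> n i \<and> d / 2 \<le> \<zeta> n - \<xi> n" .
    \<comment> \<open>The other terms of \<open>w n - p\<close> have norm at most their weight times
      \<open>a n\<close>, so the lower bound for \<open>w n\<close> falls on these two. The constant
      \<open>d\<close> may depend on \<open>i\<close>, which is fixed here.\<close>
    have "((\<lambda>n. (v n - p) - (J n i (v n) - p)) \<longlongrightarrow> 0) F"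
    proof (rule uniformly_convex_tendsto[OF uc \<open>d > 0\<close>, of a M _ _ _ "\<lambda>n. \<phi> n 0" "\<lambda>n. \<phi> n i" g])
      show "\<forall>\<^sub>F n in F. (\<phi> n 0 + \<phi> n i) * a n - g n
        \<le> norm (\<phi> n 0 *\<^sub>R (v n - p) + \<phi> n i *\<^sub>R (J n i (v n) - p))"
        using d lower_w
      proof eventually_elim
        case (elim n)
        let ?X = "\<phi> n 0 *\<^sub>R (v n - p) + \<phi> n i *\<^sub>R (J n i (v n) - p)"
        have "norm (w n - p - ?X) \<le> (1 - \<phi> n 0 - \<phi> n i) * a n"
          using w_tail_norm_le(2)[of n k] elim Suc by (simp add: a_def)
        moreover have "norm (w n - p) \<le> norm ?X + norm (w n - p - ?X)"
          by (rule norm_triangle_sub)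
        ultimately show ?case using elim by (simp add: algebra_simps)
      qed
      show "\<forall>\<^sub>F n in F. norm (J n i (v n) - p) \<le> a n"
        using d by eventually_elim (use J_dist_le v_in in \<open>auto simp: a_def\<close>)
      show "\<forall>\<^sub>F n in F. d \<le> \<phi> n 0" "\<forall>\<^sub>F n in F. d \<le> \<phi> n i"
        using d by (auto elim: eventually_mono)
    qed (use M g in \<open>auto simp: a_def\<close>)
    then show ?thesis by simp
  qed
  show "((\<lambda>n. v (Suc n) - v n) \<longlongrightarrow> 0) F"
  proof (rule tendsto_0_le[where K = 1])
    let ?b = "\<lambda>n. \<xi> n * (norm (u - p) + M) + norm (v n - J n 0 (v n))
      + (norm (w n - J n 0 (w n)) + norm (w n - v n))"
    have "(?b \<longlongrightarrow> 0 * (norm (u - p) + M) + norm (0::'a) + (norm (0::'a) + norm (0::'a))) F"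
      by (intro tendsto_intros \<xi>F vJ0v wJw wv)
    then show "(?b \<longlongrightarrow> 0) F" by simp
    show "\<forall>\<^sub>F n in F. norm (v (Suc n) - v n) \<le> norm (?b n) * 1"
      using c M
    proof eventually_elim
      case (elim n)
      then have n: "n \<ge> 1" "\<xi> n \<le> \<zeta> n" using \<open>c > 0\<close> by auto
      note rng = \<xi>[OF n(1)] \<zeta>[OF n(1)]
      have abs: "\<bar>\<xi> n\<bar> = \<xi> n" "\<bar>1 - \<zeta> n\<bar> = 1 - \<zeta> n" "\<bar>\<zeta> n - \<xi> n\<bar> = \<zeta> n - \<xi> n"
        using n rng by auto
      \<comment> \<open>Centred at \<open>v n\<close>, the step has a vanishing multiple of
        \<open>u - v n\<close> and otherwise only residuals already shown to tend to 0.\<close>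
      have diff: "v (Suc n) - v n = \<xi> n *\<^sub>R (u - v n) - (1 - \<zeta> n) *\<^sub>R (v n - J n 0 (v n))
          + (\<zeta> n - \<xi> n) *\<^sub>R ((w n - v n) - (w n - J n 0 (w n)))"
        unfolding v_Suc[OF n(1)] by (simp add: algebra_simps)
      have "norm (v (Suc n) - v n) \<le> norm (\<xi> n *\<^sub>R (u - v n)) + norm ((1 - \<zeta> n) *\<^sub>R (v n - J n 0 (v n)))
          + norm ((\<zeta> n - \<xi> n) *\<^sub>R ((w n - v n) - (w n - J n 0 (w n))))"
        unfolding diff
        by (rule order_trans[OF norm_triangle_ineq add_right_mono[OF norm_triangle_ineq4]])
      also have "\<dots> = \<xi> n * norm (u - v n) + (1 - \<zeta> n) * norm (v n - J n 0 (v n))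
          + (\<zeta> n - \<xi> n) * norm ((w n - v n) - (w n - J n 0 (w n)))"
        by (simp only: norm_scaleR abs)
      also have "\<dots> \<le> \<xi> n * (norm (u - p) + M) + 1 * norm (v n - J n 0 (v n))
          + 1 * (norm (w n - J n 0 (w n)) + norm (w n - v n))"
      proof (intro add_mono mult_mono)
        show "norm (u - v n) \<le> norm (u - p) + M"
          using norm_triangle_ineq4[of "u - p" "v n - p"] elim by (simp add: a_def)
        show "norm ((w n - v n) - (w n - J n 0 (w n))) \<le> norm (w n - J n 0 (w n)) + norm (w n - v n)"
          using norm_triangle_ineq4[of "w n - v n" "w n - J n 0 (w n)"] by simp
      qed (use n rng in auto)
      finally have "norm (v (Suc n) - v n) \<le> ?b n" by simp
      also have "\<dots> \<le> norm (?b n) * 1" by (simp only: mult_1_right real_norm_def abs_ge_self)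
      finally show ?case .
    qed
  qed
qed

end

end

section \<open>Strong convergence to the retraction point\<close>

theorem theorem4:
  fixes C :: "'a::banach set"
    and A :: "nat \<Rightarrow> 'a \<Rightarrow> 'a set"
    and rs :: "nat \<Rightarrow> real" and r :: real
    and \<xi> \<zeta> :: "nat \<Rightarrow> real"
    and \<phi> :: "nat \<Rightarrow> nat \<Rightarrow> real"
    and u :: 'a and v w :: "nat \<Rightarrow> 'a"
    and Z :: "'a set" and Q :: "'a \<Rightarrow> 'a"
  assumes "uniformly_convex TYPE('a)"
    and "has_weakly_seq_continuous_duality_map TYPE('a)"
    and "C \<noteq> {}" and "closed C" and "convex C"
    and "\<And>i. accretive (A i)"
    and "\<And>i. range_condition (A i)"
    and "\<And>i. closure (op_domain (A i)) \<subseteq> C"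
    and "\<And>i. C \<subseteq> (\<Inter>s\<in>{0<..}. op_range (id_plus s (A i)))"
    and "\<And>n. n \<ge> 1 \<Longrightarrow> rs n > 0" and "r > 0" and "rs \<longlonglongrightarrow> r"
    and "u \<in> C" and "v 1 \<in> C"
    and "\<And>n. n \<ge> 1 \<Longrightarrow> v n \<in> C" and "\<And>n. n \<ge> 1 \<Longrightarrow> w n \<in> C"
    and "\<And>n. n \<ge> 1 \<Longrightarrow>
           v (Suc n) = \<xi> n *\<^sub>R u + (1 - \<zeta> n) *\<^sub>R resolvent (rs n) (A 0) (v n)
                       + (\<zeta> n - \<xi> n) *\<^sub>R resolvent (rs n) (A 0) (w n)"
    and "\<And>n. n \<ge> 1 \<Longrightarrow>
           w n = \<phi> n 0 *\<^sub>R v n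
                 + (\<Sum>i. \<phi> n (Suc i) *\<^sub>R resolvent (rs n) (A (Suc i)) (v n))"
    and "\<And>n. n \<ge> 1 \<Longrightarrow> \<zeta> n \<in> {0..1}"
    and "\<And>n. n \<ge> 1 \<Longrightarrow> \<xi> n \<in> {0..1}"
    and "\<And>n i. n \<ge> 1 \<Longrightarrow> \<phi> n i \<in> {0..1}"
    and "\<xi> \<longlonglongrightarrow> 0"
    and "filterlim (\<lambda>N. \<Sum>n=1..N. \<xi> n) at_top sequentially"
    and "\<And>n. n \<ge> 1 \<Longrightarrow> summable (\<lambda>i. \<phi> n (Suc i))"
    and "\<And>n. n \<ge> 1 \<Longrightarrow> \<phi> n 0 + (\<Sum>i. \<phi> n (Suc i)) = 1"
    and "\<And>i. i \<ge> 1 \<Longrightarrow> liminf (\<lambda>n. ereal (\<zeta> n * \<phi> n 0 * \<phi> n i)) > 0"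
    and "Z = (\<Inter>i. op_inverse (A i) 0)" and "Z \<noteq> {}"
    and "sunny_nonexpansive_retraction Q Z"
  shows "v \<longlonglongrightarrow> Q u"
proof -
  obtain \<psi> and j :: "'a \<Rightarrow> ('a \<Rightarrow>\<^sub>L real)" where "gauge_function \<psi>" "\<And>a. duality_map \<psi> a = {j a}"
    "\<And>x l. weakly_converges x l \<Longrightarrow> weak_star_converges (\<lambda>n. j (x n)) (j l)"
    using assms(2) unfolding has_weakly_seq_continuous_duality_map_def by blast
  then interpret weakly_continuous_duality \<psi> j
    using assms(1) by unfold_locales
  have C_range: "C \<subseteq> op_range (id_plus s (A i))" if "s > 0" for i s
    using assms(9)[of i] that by blast
  interpret resolvent_iteration C A rs \<xi> \<zeta> \<phi> u v w
    by unfold_locales (fact assms C_range)+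
  define q where "q = Q u"
  have "Q u \<in> Z"
    using assms(29) by (auto simp: sunny_nonexpansive_retraction_def retraction_onto_def)
  then have zero: "0 \<in> A i q" for i using assms(27) by (auto simp: q_def op_inverse_def)
  obtain M where M: "\<forall>\<^sub>F n in sequentially. norm (v n - q) \<le> M" using v_bounded[OF zero] by blast
  have "(\<lambda>n. norm (v n - q)) \<longlonglongrightarrow> 0"
  proof (rule descent_or_contraction_tendsto_zero[OF _ M _ \<xi>_lim assms(23)])
    show "\<forall>\<^sub>F n in sequentially. 0 \<le> \<xi> n"
      using eventually_ge_at_top[of 1] by eventually_elim (use \<xi> in auto)
    fix \<epsilon> :: real assume "\<epsilon> > 0"
    let ?ok = "\<lambda>\<delta> n. norm (v (Suc n) - q) \<le> norm (v n - q) - \<delta> \<or> norm (v (Suc n) - q) \<le> \<epsilon>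
        \<or> norm (v (Suc n) - q) \<le> (1 - \<xi> n) * norm (v n - q) + \<xi> n * \<epsilon>"
    show "\<exists>\<delta>>0. \<forall>\<^sub>F n in sequentially. ?ok \<delta> n"
    proof (rule ccontr)
      assume contr: "\<not> ?thesis"
      have "\<forall>\<^sub>F n in sequentially. n \<ge> 1 \<and> \<xi> n \<le> \<zeta> n \<and> norm (v n - q) \<le> M"
        using \<xi>_le_\<zeta> M by eventually_elim auto
      then obtain N where N: "\<And>n. n \<ge> N \<Longrightarrow> n \<ge> 1 \<and> \<xi> n \<le> \<zeta> n \<and> norm (v n - q) \<le> M"
        by (auto simp: eventually_sequentially)
      \<comment> \<open>As no \<open>\<delta>\<close> works, all three alternatives fail together
        infinitely often for each \<open>\<delta> = 1 / Suc k\<close>; the subsequence collects one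
        failure per \<open>k\<close>.\<close>
      have "\<exists>\<^sub>F n in sequentially. \<not> ?ok (1 / Suc k) n \<and> n \<ge> N" for k
      proof (intro frequently_eventually_frequently eventually_ge_at_top)
        from contr have "\<not> (\<forall>\<^sub>F n in sequentially. ?ok \<delta> n)" if "\<delta> > 0" for \<delta>
          using that by blast
        from this[of "1 / Suc k"] show "\<exists>\<^sub>F n in sequentially. \<not> ?ok (1 / Suc k) n"
          by (simp only: not_eventually) simp
      qed
      then obtain s where s: "strict_mono s" "\<And>k. \<not> ?ok (1 / Suc k) (s k) \<and> s k \<ge> N"
        using frequently_subsequence[of "\<lambda>k n. \<not> ?ok (1 / Suc k) n \<and> n \<ge> N"] by blast
      \<comment> \<open>Failure of the last two alternatives puts the new distance above
        \<open>\<epsilon>\<close> and above the contracted one. Testing the recursion with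
        \<open>f\<close>, which norms \<open>v (Suc n) - q\<close>, leaves the term
        \<open>\<xi> n * f (u - q)\<close> to make up the excess.\<close>
      have large: "j (v (Suc (s k)) - q) (u - q) \<ge> \<epsilon> * \<psi> \<epsilon>" for k
      proof -
        define n where "n = s k"
        have n: "n \<ge> 1" "\<xi> n \<le> \<zeta> n" using s(2)[of k] N[of n] by (auto simp: n_def)
        let ?a = "norm (v n - q)" and ?a' = "norm (v (Suc n) - q)"
        define f where "f = j (v (Suc n) - q)"
        have a': "?a' > \<epsilon>" "?a' > (1 - \<xi> n) * ?a + \<xi> n * \<epsilon>"
          using s(2)[of k] by (auto simp: n_def)
        have pos: "0 < \<psi> \<epsilon>" "\<psi> \<epsilon> < \<psi> ?a'"
          using gauge_pos gauge_less[of \<epsilon> ?a'] a' \<open>\<epsilon> > 0\<close> by auto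
        have f_le: "f x \<le> \<psi> ?a' * ?a" if "norm x \<le> ?a" for x
          using j_le[of "v (Suc n) - q" x] mult_left_mono[OF that, of "\<psi> ?a'"] pos unfolding f_def by linarith
        have "?a' * \<psi> ?a' = f (v (Suc n) - q)" by (simp add: f_def j_self)
        also have "\<dots> = \<xi> n * f (u - q) + (1 - \<zeta> n) * f (J n 0 (v n) - q)
            + (\<zeta> n - \<xi> n) * f (J n 0 (w n) - q)"
          by (simp only: v_Suc_diff[OF zero n(1)] blinfun.add_right blinfun.scaleR_right real_scaleR_def)
        also have "\<dots> \<le> \<xi> n * f (u - q) + (1 - \<zeta> n) * (\<psi> ?a' * ?a) + (\<zeta> n - \<xi> n) * (\<psi> ?a' * ?a)"
          using n \<zeta>[OF n(1)] J_dist_le[OF zero n(1) v_in[OF n(1)], of 0]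
            J_dist_le[OF zero n(1) w_in[OF n(1)], of 0] w_norm_le[OF zero n(1)]
          by (intro add_mono mult_left_mono f_le order_refl) auto
        also have "\<dots> = \<xi> n * f (u - q) + ((1 - \<xi> n) * ?a) * \<psi> ?a'"
          by (simp add: algebra_simps)
        finally have "(?a' - (1 - \<xi> n) * ?a) * \<psi> ?a' \<le> \<xi> n * f (u - q)"
          by (simp add: left_diff_distrib)
        moreover have "\<xi> n * \<epsilon> * \<psi> ?a' < (?a' - (1 - \<xi> n) * ?a) * \<psi> ?a'"
          using a' pos by (intro mult_strict_right_mono) auto
        ultimately have "\<xi> n * (\<epsilon> * \<psi> ?a') < \<xi> n * f (u - q)" by (simp add: mult.assoc)
        \<comment> \<open>The strict inequality excludes \<open>\<xi> n = 0\<close>, so the factor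
          cancels.\<close>
        then have "\<epsilon> * \<psi> ?a' < f (u - q)"
          using \<xi>[OF n(1)] by (simp add: mult_less_cancel_left)
        moreover have "\<epsilon> * \<psi> \<epsilon> \<le> \<epsilon> * \<psi> ?a'" using pos \<open>\<epsilon> > 0\<close> by simp
        ultimately show ?thesis by (simp add: n_def f_def)
      qed
      have "bounded (range (v \<circ> s))"
        unfolding bounded_iff
      proof (intro exI ballI)
        fix x assume "x \<in> range (v \<circ> s)"
        then obtain k where "x = v (s k)" by auto
        then show "norm x \<le> M + norm q"
          using N[of "s k"] s(2)[of k] norm_triangle_sub[of "v (s k)" q] by auto
      qed
      then obtain t z where t: "strict_mono t" and z: "weakly_converges (v \<circ> s \<circ> t) z"
        by (rule uniformly_convex_weakly_convergent_subsequence[OF uc])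
      define m where "m = s \<circ> t"
      have m: "strict_mono m" unfolding m_def using s(1) t by (rule strict_mono_o)
      have m1: "m k \<ge> 1" for k using N[of "m k"] s(2)[of "t k"] by (simp add: m_def)
      \<comment> \<open>A filter on the original indices, rather than the sequence
        \<open>v \<circ> m\<close>, keeps \<open>Suc n\<close> the true successor step.\<close>
      let ?F = "filtermap m sequentially"
      have F: "?F \<le> sequentially" using filterlim_subseq[OF m] by (simp add: filterlim_def)
      \<comment> \<open>Here the failure of the first alternative enters: each drop is below
        \<open>1 / Suc (t k)\<close>.\<close>
      have "((\<lambda>n. max 0 (norm (v n - q) - norm (v (Suc n) - q))) \<longlongrightarrow> 0) ?F"
        unfolding filterlim_filtermap
      proof (rule tendsto_sandwich[OF _ _ tendsto_const])
        have "(\<lambda>k. 1 / Suc k) \<longlonglongrightarrow> (0::real)" by (rule LIMSEQ_Suc[OF lim_1_over_n])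
        then show "(\<lambda>k. 1 / Suc (t k)) \<longlonglongrightarrow> (0::real)"
          using LIMSEQ_subseq_LIMSEQ[OF _ t] by (auto simp: comp_def)
        have "max 0 (norm (v (m k) - q) - norm (v (Suc (m k)) - q)) \<le> 1 / Suc (t k)" for k
          using s(2)[of "t k"] by (simp add: m_def not_le)
        then show "\<forall>\<^sub>F k in sequentially.
            max 0 (norm (v (m k) - q) - norm (v (Suc (m k)) - q)) \<le> 1 / Suc (t k)" by simp
      qed simp
      note regular = asymptotic_regularity[OF zero F this, unfolded filterlim_filtermap]
      have weak: "weakly_converges (\<lambda>k. v (m k)) z"
        using z by (simp add: m_def comp_def)
      have "0 \<in> A i z" for i
      proof (rule resolvent_demiclosed[OF accretive assms(4,5) C_range _ _ weak _ _ \<open>r > 0\<close> regular(1)])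
        show "v (m k) \<in> C" for k by (rule v_in[OF m1])
        show "rs (m k) > 0" for k by (rule rs_pos[OF m1])
        show "(\<lambda>k. rs (m k)) \<longlonglongrightarrow> r"
          using LIMSEQ_subseq_LIMSEQ[OF assms(12) m] by (simp add: comp_def)
        show "bounded (range (\<lambda>k. v (m k)))"
          using \<open>bounded (range (v \<circ> s))\<close> by (rule bounded_subset) (auto simp: m_def)
      qed
      then have "z \<in> Z" using assms(27) by (auto simp: op_inverse_def)
      \<comment> \<open>Consecutive iterates become close in norm, so the successors inherit the
        weak limit \<open>z\<close>.\<close>
      have "weakly_converges (\<lambda>k. v (Suc (m k)) - q) (z - q)"
        unfolding weakly_converges_def
      proof
        fix f :: "'a \<Rightarrow>\<^sub>L real"
        have "(\<lambda>k. f (v (Suc (m k)) - v (m k)) + f (v (m k)) - f q) \<longlonglongrightarrow> f 0 + f z - f q"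
        proof (intro tendsto_diff tendsto_add tendsto_const)
          show "(\<lambda>k. f (v (Suc (m k)) - v (m k))) \<longlonglongrightarrow> f 0" by (intro tendsto_intros regular(2))
          show "(\<lambda>k. f (v (m k))) \<longlonglongrightarrow> f z" using weak by (simp add: weakly_converges_def)
        qed
        then show "(\<lambda>k. f (v (Suc (m k)) - q)) \<longlonglongrightarrow> f (z - q)"
          by (simp add: blinfun.diff_right)
      qed
      then have "(\<lambda>k. j (v (Suc (m k)) - q) (u - q)) \<longlonglongrightarrow> j (z - q) (u - q)"
        using weak_continuous by (simp add: weak_star_converges_def)
      then have "\<epsilon> * \<psi> \<epsilon> \<le> j (z - q) (u - q)"
        using large by (intro LIMSEQ_le_const[of _ "j (z - q) (u - q)"]) (auto simp: m_def)
      moreover have "j (z - q) (u - q) \<le> 0"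
        unfolding q_def by (rule sunny_retraction_variational[OF assms(29) \<open>z \<in> Z\<close>])
      moreover have "0 < \<epsilon> * \<psi> \<epsilon>" using \<open>\<epsilon> > 0\<close> gauge_pos by simp
      ultimately show False by linarith
    qed
  qed simp
  then show ?thesis by (simp add: q_def LIM_zero_iff tendsto_norm_zero_iff)
qed

end
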